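(* The group \[G=\langle a,b,c,s,t\mid sas^{-1}=ab,\ sbs^{-1}=b,\ scs^{-1}=c,\ tat^{-1}=ba,\ tbt^{-1}=b,\ tct^{-1}=c\rangle,\] which is of the form $F_3\rtimes F_2$ (with $F_3=F(a,b,c)$ and $F_2=F(s,t)$), has undecidable Diophantine problem.
   Context: The Diophantine problem for a finitely generated group $G$ asks for an algorithm that, given a finite system of equations over $G$ (elements of $G*F(\mathcal X)$ for a finite set of variables $\mathcal X$), decides whether there is a homomorphism $G*F(\mathcal X)\to G$ restricting to the identity on $G$ and sending each equation to $1$. *)

theory Defs
  imports Main "HOL-Library.Nat_Bijection"
begin

datatype recf = Zero | Succ | Proj nat | Comp recf "recf list" | Prim recf recf | Mn recf

inductive eval :: "recf \<Rightarrow> nat list \<Rightarrow> nat \<Rightarrow> bool" where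
  zero: "eval Zero xs 0"
| succ: "eval Succ (x # xs) (Suc x)"
| proj: "i < length xs \<Longrightarrow> eval (Proj i) xs (xs ! i)"
| comp: "length ys = length gs \<Longrightarrow> (\<forall>i<length gs. eval (gs ! i) xs (ys ! i))
          \<Longrightarrow> eval f ys y \<Longrightarrow> eval (Comp f gs) xs y"
| prim0: "eval f xs y \<Longrightarrow> eval (Prim f g) (0 # xs) y"
| primS: "eval (Prim f g) (n # xs) z \<Longrightarrow> eval g (z # n # xs) y
          \<Longrightarrow> eval (Prim f g) (Suc n # xs) y"
| mn: "eval f (n # xs) 0 \<Longrightarrow> (\<forall>m<n. \<exists>y. 0 < y \<and> eval f (m # xs) y)
          \<Longrightarrow> eval (Mn f) xs n"

definition decidable_set :: "nat set \<Rightarrow> bool" where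
  "decidable_set A \<longleftrightarrow> (\<exists>f. \<forall>n. eval f [n] (if n \<in> A then 1 else 0))"

text \<open>A letter is (i, e): i < 5 is a generator of G (a=0, b=1, c=2, s=3, t=4);
  i \<ge> 5 is the variable number i - 5.  e = True means the letter itself, False its inverse.\<close>
type_synonym letter = "nat \<times> bool"
type_synonym word = "letter list"

definition inv_word :: "word \<Rightarrow> word" where
  "inv_word w = rev (map (\<lambda>(i, e). (i, \<not> e)) w)"

abbreviation (input) gA :: nat where "gA \<equiv> 0"
abbreviation (input) gB :: nat where "gB \<equiv> 1"
abbreviation (input) gC :: nat where "gC \<equiv> 2"
abbreviation (input) gS :: nat where "gS \<equiv> 3"
abbreviation (input) gT :: nat where "gT \<equiv> 4"

definition relators :: "word set" where
  "relators = {
     [(gS,True),(gA,True),(gS,False)] @ inv_word [(gA,True),(gB,True)],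
     [(gS,True),(gB,True),(gS,False)] @ inv_word [(gB,True)],
     [(gS,True),(gC,True),(gS,False)] @ inv_word [(gC,True)],
     [(gT,True),(gA,True),(gT,False)] @ inv_word [(gB,True),(gA,True)],
     [(gT,True),(gB,True),(gT,False)] @ inv_word [(gB,True)],
     [(gT,True),(gC,True),(gT,False)] @ inv_word [(gC,True)] }"

inductive G_eq :: "word \<Rightarrow> word \<Rightarrow> bool" where
  refl: "G_eq u u"
| sym: "G_eq u v \<Longrightarrow> G_eq v u"
| trans: "G_eq u v \<Longrightarrow> G_eq v w \<Longrightarrow> G_eq u w"
| ctxt: "G_eq u v \<Longrightarrow> G_eq (p @ u @ q) (p @ v @ q)"
| cancel: "G_eq [(i, e), (i, \<not> e)] []"
| rel: "r \<in> relators \<Longrightarrow> G_eq r []"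

definition G_word :: "word \<Rightarrow> bool" where
  "G_word w \<longleftrightarrow> (\<forall>(i, e) \<in> set w. i < 5)"

definition subst :: "(nat \<Rightarrow> word) \<Rightarrow> word \<Rightarrow> word" where
  "subst \<sigma> w = concat (map (\<lambda>(i, e). if i < 5 then [(i, e)]
                                    else if e then \<sigma> i else inv_word (\<sigma> i)) w)"

definition solvable :: "word list \<Rightarrow> bool" where
  "solvable sys \<longleftrightarrow> (\<exists>\<sigma>. (\<forall>i. G_word (\<sigma> i)) \<and> (\<forall>w \<in> set sys. G_eq (subst \<sigma> w) []))"

text \<open>Goedel numbering of systems (a bijection between word lists and nat).\<close>
definition letter_code :: "letter \<Rightarrow> nat" where
  "letter_code l = 2 * fst l + (if snd l then 1 else 0)"

definition system_code :: "word list \<Rightarrow> nat" where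
  "system_code sys = list_encode (map (\<lambda>w. list_encode (map letter_code w)) sys)"

definition diophantine_problem_G :: "nat set" where
  "diophantine_problem_G = {system_code sys | sys. solvable sys}"

end

theory Submission
  imports "HOL-Number_Theory.Number_Theory" "HOL-Library.Countable" Defs
begin

text \<open>
  The integers with addition and multiplication are interpreted in the group by systems of equations.
  The integer \<open>n\<close> is represented by \<open>s\<^sup>n\<close>; an element \<open>Z\<close> commuting with \<open>s\<^sup>m t\<close> has
  \<open>s\<close>-exponent \<open>m\<close> times its \<open>t\<close>-exponent, and \<open>Z a = b\<^sup>i a b\<^sup>j Z\<close> forces these exponents to be
  \<open>j\<close> and \<open>i\<close>.  That every solution is of this kind is seen from two invariants: the image in a Heisenberg
  group, where commuting elements have proportional exponent vectors, and a right action of the group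
  on \<open>SL\<^sub>2(\<int>) \<times> \<int>\<^sup>2\<close>, where \<open>b\<^sup>i a b\<^sup>j\<close> determines \<open>i\<close> and \<open>j\<close>.

  Hence every Diophantine relation, and by the theorem of Davis, Putnam, Robinson and Matiyasevich
  every graph of a recursive function, is expressed by a system over the group.  If solvability were
  decidable, so would be the set of codes of systems that become unsolvable when their own code is
  substituted for a distinguished variable; a system expressing membership in this set then
  contradicts itself at its own code.
\<close>

section \<open>Diophantine relations over the natural numbers\<close>

text \<open>The generators \<open>s\<close> and \<open>t\<close> fix \<open>b\<close> and
  \<open>c\<close>, so conjugation of \<open>a\<close> by a word in \<open>s\<close> and
  \<open>t\<close> sees only its exponent sums. Adding exponents is then easy, but a product has to
  come from the noncommutativity of \<open>s\<close> and \<open>t\<close>. Their abelianisation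
  cannot provide it, since there everything commutes; in the next nilpotent quotient, the Heisenberg
  group, commuting means that a 2 by 2 determinant of exponents vanishes, and this is a
  multiplicative relation. The generator \<open>c\<close> confines the variables: an element
  commuting with \<open>b\<close> and \<open>c\<close> has trivial component in
  \<open>F(a, b, c)\<close>. The matrices only show this component to be scalar, which is enough
  because a nonzero scalar cancels. Exponents are integers while Diophantine unknowns are natural
  numbers; sums of four squares bridge the gap. Graphs of recursive functions hinge on bounded
  universal quantification, which is what exponentiation, binomial coefficients and factorials are
  for. Diagonalising on codes of systems asks for just one concrete computable function besides the
  supposed decision procedure, and for no universal function.\<close>

datatype pexp = Par nat | Unk nat | PZero | POne | PAdd pexp pexp | PMul pexp pexp

text \<open>The semiring is left open: the same expression is evaluated over \<open>nat\<close> for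
  Diophantine relations and over \<open>int\<close> for exponents in the group.\<close>

primrec pval :: "pexp \<Rightarrow> (nat \<Rightarrow> 'a::comm_semiring_1) \<Rightarrow> (nat \<Rightarrow> 'a) \<Rightarrow> 'a" where
  "pval (Par i) v w = v i"
| "pval (Unk i) v w = w i"
| "pval PZero v w = 0"
| "pval POne v w = 1"
| "pval (PAdd p q) v w = pval p v w + pval q v w"
| "pval (PMul p q) v w = pval p v w * pval q v w"

primrec psub :: "(nat \<Rightarrow> pexp) \<Rightarrow> (nat \<Rightarrow> pexp) \<Rightarrow> pexp \<Rightarrow> pexp" where
  "psub f g (Par i) = f i"
| "psub f g (Unk i) = g i"
| "psub f g PZero = PZero"
| "psub f g POne = POne"
| "psub f g (PAdd p q) = PAdd (psub f g p) (psub f g q)"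
| "psub f g (PMul p q) = PMul (psub f g p) (psub f g q)"

lemma pval_psub:
  "pval (psub f g p) v w = pval p (\<lambda>i. pval (f i) v w) (\<lambda>i. pval (g i) v w)"
  by (induction p) auto

definition dioph :: "((nat \<Rightarrow> nat) \<Rightarrow> bool) \<Rightarrow> bool" where
  "dioph P \<longleftrightarrow> (\<exists>p q. \<forall>v. P v \<longleftrightarrow> (\<exists>w. pval p v w = pval q v w))"

definition dfun :: "((nat \<Rightarrow> nat) \<Rightarrow> nat) \<Rightarrow> bool" where
  "dfun f \<longleftrightarrow> dioph (\<lambda>v. v 0 = f (\<lambda>i. v (Suc i)))"

lemma diophI: "(\<And>v. P v \<longleftrightarrow> (\<exists>w. pval p v w = pval q v w)) \<Longrightarrow> dioph P"
  by (auto simp: dioph_def)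

text \<open>Interleaving lets one sequence of unknowns serve as two independent ones. It keeps the
  unknowns of a conjunction apart and makes room for quantified sequences.\<close>

lemma ex_even_odd:
  "(\<exists>w :: nat \<Rightarrow> 'a. P (\<lambda>i. w (2 * i)) (\<lambda>i. w (Suc (2 * i)))) \<longleftrightarrow> (\<exists>w1 w2. P w1 w2)"
proof
  assume "\<exists>w1 w2. P w1 w2"
  then obtain w1 w2 where "P w1 w2" by blast
  then show "\<exists>w :: nat \<Rightarrow> 'a. P (\<lambda>i. w (2 * i)) (\<lambda>i. w (Suc (2 * i)))"
    by (intro exI[of _ "\<lambda>i. if even i then w1 (i div 2) else w2 (i div 2)"]) simp
qed blast

text \<open>This is \<open>(a - b)^2 + (c - d)^2 = 0\<close> with the negative terms moved across,
  since expressions have natural coefficients only.\<close>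

lemma sum_squares_eq_iff:
  "a * a + b * b + (c * c + d * d) = a * b + a * b + (c * d + c * d) \<longleftrightarrow> a = b \<and> c = (d :: nat)"
proof -
  have "a * a + b * b + (c * c + d * d) = a * b + a * b + (c * d + c * d) \<longleftrightarrow>
      int a * int a + int b * int b + (int c * int c + int d * int d) =
      int a * int b + int a * int b + (int c * int d + int c * int d)"
    by (simp only: of_nat_add[symmetric] of_nat_mult[symmetric] of_nat_eq_iff)
  also have "\<dots> \<longleftrightarrow> (int a - int b)\<^sup>2 + (int c - int d)\<^sup>2 = 0"
    by (auto simp: power2_eq_square left_diff_distrib right_diff_distrib mult.commute)
  finally show ?thesis by (simp add: sum_power2_eq_zero_iff)
qed

text \<open>This is \<open>(a - b) * (c - d) = 0\<close> without subtraction.\<close>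

lemma cross_products_eq_iff:
  "a * c + b * d = a * d + b * c \<longleftrightarrow> a = b \<or> c = (d :: nat)"
proof -
  have "a * c + b * d = a * d + b * c \<longleftrightarrow>
      int a * int c + int b * int d = int a * int d + int b * int c"
    by (simp only: of_nat_add[symmetric] of_nat_mult[symmetric] of_nat_eq_iff)
  also have "\<dots> \<longleftrightarrow> (int a - int b) * (int c - int d) = 0"
    by (simp only: left_diff_distrib right_diff_distrib) linarith
  finally show ?thesis by simp
qed

lemma dioph_conj:
  assumes "dioph P" and "dioph Q"
  shows "dioph (\<lambda>v. P v \<and> Q v)"
proof -
  obtain p q where P: "\<And>v. P v \<longleftrightarrow> (\<exists>w. pval p v w = pval q v w)"
    using assms(1) unfolding dioph_def by blast
  obtain p' q' where Q: "\<And>v. Q v \<longleftrightarrow> (\<exists>w. pval p' v w = pval q' v w)"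
    using assms(2) unfolding dioph_def by blast
  let ?e = "psub Par (\<lambda>i. Unk (2 * i))" and ?o = "psub Par (\<lambda>i. Unk (Suc (2 * i)))"
  let ?a = "?e p" and ?b = "?e q" and ?c = "?o p'" and ?d = "?o q'"
  have eq: "P v \<and> Q v \<longleftrightarrow> (\<exists>w. pval ?a v w = pval ?b v w \<and> pval ?c v w = pval ?d v w)" for v
    using ex_even_odd[of "\<lambda>w1 w2. pval p v w1 = pval q v w1 \<and> pval p' v w2 = pval q' v w2"]
    by (simp add: pval_psub P Q)
  show ?thesis
    by (rule diophI[of _
          "PAdd (PAdd (PMul ?a ?a) (PMul ?b ?b)) (PAdd (PMul ?c ?c) (PMul ?d ?d))"
          "PAdd (PAdd (PMul ?a ?b) (PMul ?a ?b)) (PAdd (PMul ?c ?d) (PMul ?c ?d))"])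
      (simp add: sum_squares_eq_iff eq)
qed

lemma dioph_disj:
  assumes "dioph P" and "dioph Q"
  shows "dioph (\<lambda>v. P v \<or> Q v)"
proof -
  obtain p q where P: "\<And>v. P v \<longleftrightarrow> (\<exists>w. pval p v w = pval q v w)"
    using assms(1) unfolding dioph_def by blast
  obtain p' q' where Q: "\<And>v. Q v \<longleftrightarrow> (\<exists>w. pval p' v w = pval q' v w)"
    using assms(2) unfolding dioph_def by blast
  have eq: "P v \<or> Q v \<longleftrightarrow>
      (\<exists>w. pval p v w = pval q v w \<or> pval p' v w = pval q' v w)" for v
    by (auto simp: P Q)
  show ?thesis
    by (rule diophI[of _ "PAdd (PMul p p') (PMul q q')" "PAdd (PMul p q') (PMul q p')"])
      (simp add: cross_products_eq_iff eq)
qed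

text \<open>Quantifying over a whole sequence serves where the number of new unknowns depends on an
  expression or on a list of functions.\<close>

lemma dioph_exs:
  assumes "dioph (\<lambda>v. Q (\<lambda>i. v (2 * i)) (\<lambda>i. v (Suc (2 * i))))"
  shows "dioph (\<lambda>v. \<exists>w. Q w v)"
proof -
  obtain p q where P: "\<And>v. Q (\<lambda>i. v (2 * i)) (\<lambda>i. v (Suc (2 * i))) \<longleftrightarrow>
      (\<exists>w. pval p v w = pval q v w)"
    using assms unfolding dioph_def by blast
  let ?S = "psub (\<lambda>i. if even i then Unk (2 * (i div 2)) else Par (i div 2)) (\<lambda>i. Unk (Suc (2 * i)))"
  show ?thesis
  proof (rule diophI[of _ "?S p" "?S q"])
    fix v
    define V where "V w = (\<lambda>i. if even i then w (i div 2) else v (i div 2))" for w :: "nat \<Rightarrow> nat"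
    have S: "pval (?S e) v w = pval e (V (\<lambda>i. w (2 * i))) (\<lambda>i. w (Suc (2 * i)))" for e w
      unfolding pval_psub V_def by (rule arg_cong2[where f = "pval e"]) auto
    have Q: "Q w v \<longleftrightarrow> (\<exists>u. pval p (V w) u = pval q (V w) u)" for w
      using P[of "V w"] by (simp add: V_def)
    show "(\<exists>w. Q w v) \<longleftrightarrow> (\<exists>w. pval (?S p) v w = pval (?S q) v w)"
      unfolding S Q
      using ex_even_odd[of "\<lambda>w1 w2. pval p (V w1) w2 = pval q (V w1) w2"] by simp
  qed
qed

lemma dioph_ren:
  assumes "dioph P"
  shows "dioph (\<lambda>v. P (\<lambda>i. v (r i)))"
proof -
  obtain p q where P: "\<And>v. P v \<longleftrightarrow> (\<exists>w. pval p v w = pval q v w)"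
    using assms unfolding dioph_def by blast
  show ?thesis
    by (rule diophI[of _ "psub (\<lambda>i. Par (r i)) Unk p" "psub (\<lambda>i. Par (r i)) Unk q"])
      (simp add: pval_psub P)
qed

lemma dioph_ex:
  assumes "dioph (\<lambda>v. Q (v 0) (\<lambda>i. v (Suc i)))"
  shows "dioph (\<lambda>v. \<exists>x. Q x v)"
proof -
  have "dioph (\<lambda>v. \<exists>w. Q (w (0::nat)) v)"
    by (rule dioph_exs)
      (use dioph_ren[OF assms, of "\<lambda>i. case i of 0 \<Rightarrow> 0 | Suc j \<Rightarrow> Suc (2 * j)"] in simp)
  moreover have "(\<exists>w. Q (w (0::nat)) v) \<longleftrightarrow> (\<exists>x. Q x v)" for v
    by (auto intro: exI[of _ "\<lambda>_. x" for x])
  ultimately show ?thesis by simp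
qed

lemma dfun_pexp: "dfun (\<lambda>v. pval p v (\<lambda>_. 0))"
  unfolding dfun_def
  by (rule diophI[of _ "Par 0" "psub (\<lambda>i. Par (Suc i)) (\<lambda>_. PZero) p"]) (simp add: pval_psub)

lemma dfun_par: "dfun (\<lambda>v. v i)"
  using dfun_pexp[of "Par i"] by simp

lemma dfun_ren: "dfun f \<Longrightarrow> dfun (\<lambda>v. f (\<lambda>i. v (r i)))"
  unfolding dfun_def
  by (drule dioph_ren[of _ "\<lambda>i. case i of 0 \<Rightarrow> 0 | Suc j \<Rightarrow> Suc (r j)"]) simp

lemma dioph_comp:
  assumes "dfun f" and "dioph (\<lambda>v. Q (v 0) (\<lambda>i. v (Suc i)))"
  shows "dioph (\<lambda>v. Q (f v) v)"
proof -
  have "dioph (\<lambda>v. \<exists>x. x = f v \<and> Q x v)"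
    by (rule dioph_ex, rule dioph_conj) (use assms in \<open>simp_all add: dfun_def\<close>)
  then show ?thesis by simp
qed

lemma dioph_comp2:
  assumes "dfun f" "dfun g" and "dioph (\<lambda>v. Q (v 0) (v 1))"
  shows "dioph (\<lambda>v. Q (f v) (g v))"
proof (rule dioph_comp[OF assms(1)])
  show "dioph (\<lambda>v. Q (v 0) (g (\<lambda>i. v (Suc i))))"
    by (rule dioph_comp[OF dfun_ren[OF assms(2)]])
      (use dioph_ren[OF assms(3), of "\<lambda>i. if i = 0 then 1 else 0"] in simp)
qed

lemma dioph_comp3:
  assumes "dfun f" "dfun g" "dfun h" and "dioph (\<lambda>v. Q (v 0) (v 1) (v 2))"
  shows "dioph (\<lambda>v. Q (f v) (g v) (h v))"
proof (rule dioph_comp[OF assms(1)], rule dioph_comp[OF dfun_ren[OF assms(2)]],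
    rule dioph_comp[OF dfun_ren[OF assms(3)]])
  show "dioph (\<lambda>v. Q (v (Suc (Suc 0))) (v (Suc 0)) (v 0))"
    using dioph_ren[OF assms(4), of "\<lambda>i. 2 - i"] by (simp add: numeral_2_eq_2)
qed

lemma dfunI2:
  assumes "dfun f" "dfun g" and "dioph (\<lambda>v. v 0 = F (v 1) (v 2))"
  shows "dfun (\<lambda>v. F (f v) (g v))"
  unfolding dfun_def
  by (rule dioph_comp3[where Q = "\<lambda>x y z. x = F y z", OF dfun_par dfun_ren[OF assms(1)]
        dfun_ren[OF assms(2)] assms(3)])

lemma dioph_eq:
  assumes "dfun f" "dfun g"
  shows "dioph (\<lambda>v. f v = g v)"
  by (rule dioph_comp2[OF assms]) (rule diophI[of _ "Par 0" "Par 1"], simp)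

lemma dfun_add: "dfun f \<Longrightarrow> dfun g \<Longrightarrow> dfun (\<lambda>v. f v + g v)"
  by (rule dfunI2, assumption, assumption, rule diophI[of _ "Par 0" "PAdd (Par 1) (Par 2)"]) simp

lemma dfun_mult: "dfun f \<Longrightarrow> dfun g \<Longrightarrow> dfun (\<lambda>v. f v * g v)"
  by (rule dfunI2, assumption, assumption, rule diophI[of _ "Par 0" "PMul (Par 1) (Par 2)"]) simp

lemma dfun_const: "dfun (\<lambda>v. n)"
proof (induction n)
  case 0
  show ?case using dfun_pexp[of PZero] by simp
next
  case (Suc n)
  show ?case using dfun_add[OF dfun_pexp[of POne] Suc] by simp
qed

lemma dfun_Suc: "dfun f \<Longrightarrow> dfun (\<lambda>v. Suc (f v))"
  by (drule dfun_add[OF dfun_const[of 1]]) simp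

text \<open>Closure rules gather here, so that \<open>intro dio\<close> proves a relation
  Diophantine by following the shape of its definition.\<close>

named_theorems dio
lemmas [dio] = dioph_ex dioph_conj dioph_disj dioph_eq dfun_par dfun_const dfun_add dfun_mult dfun_Suc

section \<open>Order, divisibility, congruence, remainder and quotient\<close>

lemma dioph_le [dio]:
  assumes "dfun f" "dfun g"
  shows "dioph (\<lambda>v. f v \<le> g v)"
  unfolding le_iff_add by (intro dio dfun_ren[OF assms(1)] dfun_ren[OF assms(2)])

lemma dioph_less [dio]: "dfun f \<Longrightarrow> dfun g \<Longrightarrow> dioph (\<lambda>v. f v < g v)"
  unfolding Suc_le_eq[symmetric] by (intro dio)

lemma dioph_dvd [dio]:
  assumes "dfun f" "dfun g"
  shows "dioph (\<lambda>v. f v dvd g v)"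
  unfolding dvd_def by (intro dio dfun_ren[OF assms(1)] dfun_ren[OF assms(2)])

lemma cong_nat_iff: "[a = b] (mod m) \<longleftrightarrow> (\<exists>p q. a + p * m = b + q * (m :: nat))"
  by (subst cong_sym_eq) (rule cong_iff_lin_nat)

lemma dioph_cong [dio]:
  assumes "dfun f" "dfun g" "dfun h"
  shows "dioph (\<lambda>v. [f v = g v] (mod h v))"
  unfolding cong_nat_iff
  by (intro dio dfun_ren[OF assms(1)] dfun_ren[OF assms(2)] dfun_ren[OF assms(3)])

lemma dfun_mod [dio]:
  assumes "dfun f" "dfun g"
  shows "dfun (\<lambda>v. f v mod g v)"
proof (rule dfunI2[OF assms])
  \<comment> \<open>For \<open>b = 0\<close> the remainder is \<open>a\<close> itself, and
    congruence modulo 0 is equality.\<close>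
  have "r = a mod b \<longleftrightarrow> [r = a] (mod b) \<and> (r < b \<or> b = 0)" for r a b :: nat
    by (auto simp: cong_def)
  then show "dioph (\<lambda>v. v 0 = v 1 mod v 2)" by (simp only:) (intro dio)
qed

lemma dfun_div [dio]:
  assumes "dfun f" "dfun g"
  shows "dfun (\<lambda>v. f v div g v)"
proof (rule dfunI2[OF assms])
  have "r = a div b \<longleftrightarrow> b = 0 \<and> r = 0 \<or> b * r \<le> a \<and> a < b * Suc r" for r a b :: nat
    by (cases "b = 0") (auto simp: dividend_less_times_div intro: div_nat_eqI[symmetric])
  then show "dioph (\<lambda>v. v 0 = v 1 div v 2)" by (simp only:) (intro dio)
qed

lemma dioph_Ball_fixed:
  assumes "\<And>j. j < m \<Longrightarrow> dioph (R j)"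
  shows "dioph (\<lambda>v. \<forall>j<m::nat. R j v)"
  using assms
proof (induction m)
  case 0
  have "dioph (\<lambda>v. (0::nat) = 0)" by (intro dio)
  then show ?case by simp
next
  case (Suc m)
  have "dioph (\<lambda>v. (\<forall>j<m. R j v) \<and> R m v)" by (rule dioph_conj) (simp_all add: Suc)
  then show ?case by (simp add: less_Suc_eq imp_disjL all_conj_distrib)
qed

lemma dfun_pval:
  assumes "\<And>i. dfun (\<lambda>v. f v i)" and "\<And>i. dfun (\<lambda>v. g v i)"
  shows "dfun (\<lambda>v. pval p (f v) (g v))"
  by (induction p) (simp_all add: dfun_const dfun_add dfun_mult assms)

section \<open>Solutions of the Pell equation\<close>

text \<open>\<open>pX a n + pY a n * sqrt (a * a - 1)\<close> is the \<open>n\<close>-th power of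
  \<open>a + sqrt (a * a - 1)\<close>.\<close>

fun pX :: "int \<Rightarrow> nat \<Rightarrow> int" and pY :: "int \<Rightarrow> nat \<Rightarrow> int" where
  "pX a 0 = 1"
| "pX a (Suc n) = a * pX a n + (a * a - 1) * pY a n"
| "pY a 0 = 0"
| "pY a (Suc n) = pX a n + a * pY a n"

lemma pell_eq: "pX a n * pX a n = 1 + (a * a - 1) * (pY a n * pY a n)"
proof (induction n)
  case (Suc n)
  have "pX a (Suc n) * pX a (Suc n) - (a * a - 1) * (pY a (Suc n) * pY a (Suc n)) =
      pX a n * pX a n - (a * a - 1) * (pY a n * pY a n)"
    by (simp add: algebra_simps)
  with Suc show ?case by simp
qed simp

lemma pell_add:
  "pX a (m + n) = pX a m * pX a n + (a * a - 1) * (pY a m * pY a n) \<and>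
   pY a (m + n) = pX a m * pY a n + pY a m * pX a n"
proof (induction m)
  case (Suc m)
  show ?case
    unfolding add_Suc pX.simps pY.simps Suc[THEN conjunct1] Suc[THEN conjunct2]
    by (simp add: algebra_simps)
qed simp

lemmas pX_add = pell_add[THEN conjunct1]
lemmas pY_add = pell_add[THEN conjunct2]

text \<open>The power with exponent \<open>l + j\<close> is multiplied by the conjugate, which is
  the inverse, of the power with exponent \<open>j\<close>.\<close>

lemma pX_diff: "pX a l = pX a (l + j) * pX a j - (a * a - 1) * (pY a (l + j) * pY a j)"
proof -
  have "pX a (l + j) * pX a j - (a * a - 1) * (pY a (l + j) * pY a j) =
      pX a l * (pX a j * pX a j - (a * a - 1) * (pY a j * pY a j))"
    by (simp add: pX_add pY_add algebra_simps)
  then show ?thesis by (simp add: pell_eq)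
qed

lemma pell_pos:
  assumes "a \<ge> 2"
  shows "pX a n \<ge> 1 \<and> pY a n \<ge> 0"
proof (induction n)
  case (Suc n)
  have "a * pX a n \<ge> 1 * 1" using Suc assms by (intro mult_mono) auto
  moreover have "a * a \<ge> 1 * 1" using assms by (intro mult_mono) auto
  then have "(a * a - 1) * pY a n \<ge> 0" using Suc by simp
  moreover have "a * pY a n \<ge> 0" using Suc assms by simp
  ultimately show ?case using Suc by auto
qed simp

lemma pY_strict_Suc:
  assumes "a \<ge> 2"
  shows "pY a n < pY a (Suc n)"
proof -
  have "1 * pY a n \<le> a * pY a n" using assms pell_pos[OF assms] by (intro mult_right_mono) auto
  then show ?thesis using pell_pos[OF assms, of n] by simp
qed

lemma pX_Suc_ge:
  assumes "a \<ge> 2"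
  shows "a * pX a n \<le> pX a (Suc n)"
proof -
  have "a * a \<ge> 1 * 1" using assms by (intro mult_mono) auto
  then show ?thesis using pell_pos[OF assms, of n] by simp
qed

lemma pX_strict_Suc:
  assumes "a \<ge> 2"
  shows "pX a n < pX a (Suc n)"
proof -
  have "2 * pX a n \<le> a * pX a n"
    using assms pell_pos[OF assms, of n] by (intro mult_right_mono) auto
  then show ?thesis using pX_Suc_ge[OF assms, of n] pell_pos[OF assms, of n] by linarith
qed

lemma pY_strict_mono: "a \<ge> 2 \<Longrightarrow> strict_mono (pY a)"
  by (simp add: strict_mono_Suc_iff pY_strict_Suc del: pY.simps)

lemma pX_strict_mono: "a \<ge> 2 \<Longrightarrow> strict_mono (pX a)"
  by (simp add: strict_mono_Suc_iff pX_strict_Suc del: pX.simps)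

lemma pY_ge_index:
  assumes "a \<ge> 2"
  shows "int n \<le> pY a n"
proof (induction n)
  case (Suc n)
  then show ?case using pY_strict_Suc[OF assms, of n] by linarith
qed simp

lemma pY_ge_power:
  assumes "a \<ge> 2"
  shows "a ^ n \<le> pY a (Suc n)"
proof (induction n)
  case (Suc n)
  have "a * a ^ n \<le> a * pY a (Suc n)" using Suc assms by (intro mult_left_mono) auto
  then show ?case using pell_pos[OF assms, of "Suc n"] by (simp del: pX.simps)
qed simp

text \<open>Descent: multiplication by the inverse \<open>a - sqrt (a * a - 1)\<close> turns a
  solution with positive \<open>y\<close> into one with smaller \<open>y\<close>, until
  \<open>(1, 0)\<close> is reached.\<close>

lemma pell_complete:
  assumes a: "a \<ge> 2" and "x \<ge> 0" and "y \<ge> 0" and "x * x = 1 + (a * a - 1) * (y * y)"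
  shows "\<exists>n. x = pX a n \<and> y = pY a n"
  using assms(2-)
proof (induction "nat y" arbitrary: x y rule: less_induct)
  case less
  show ?case
  proof (cases "y = 0")
    case True
    with less.prems have "x = 1" by (simp add: zmult_eq_1_iff)
    with True show ?thesis by (intro exI[of _ 0]) simp
  next
    case False
    then have y: "y \<ge> 1" using less.prems by linarith
    have eq: "x * x = 1 + (a * a - 1) * (y * y)" by (rule less.prems)
    have yy: "y * y \<ge> 1" using y mult_mono[of 1 y 1 y] by simp
    \<comment> \<open>The three bounds say that the new solution \<open>(?x, ?y)\<close> has
      \<open>?y \<ge> 0\<close>, \<open>?y < y\<close> and \<open>?x \<ge> 0\<close>.\<close>
    have x_le: "x \<le> a * y"
    proof (rule power2_le_imp_le)
      show "x\<^sup>2 \<le> (a * y)\<^sup>2" using eq yy by (simp add: power2_eq_square algebra_simps)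
      show "0 \<le> a * y" using a y by simp
    qed
    have x_gt: "(a - 1) * y < x"
    proof (rule power2_less_imp_less)
      have "2 * (y * y) \<le> a * 2 * (y * y)" using a yy by (intro mult_right_mono) auto
      then show "((a - 1) * y)\<^sup>2 < x\<^sup>2" using eq by (simp add: power2_eq_square algebra_simps)
      show "0 \<le> x" by (rule less.prems)
    qed
    have x_ge: "(a * a - 1) * y \<le> a * x"
    proof (rule power2_le_imp_le)
      have "(a * x)\<^sup>2 - ((a * a - 1) * y)\<^sup>2 =
          a * a * (x * x) - (a * a - 1) * (a * a - 1) * (y * y)"
        by (simp add: power2_eq_square algebra_simps)
      also have "\<dots> = a * a + (a * a - 1) * (y * y)"
        unfolding eq by (simp add: algebra_simps)
      also have "a * a \<ge> 1 * 1" using a by (intro mult_mono) auto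
      then have "a * a + (a * a - 1) * (y * y) \<ge> 0" using yy by auto
      finally show "((a * a - 1) * y)\<^sup>2 \<le> (a * x)\<^sup>2" by simp
      show "0 \<le> a * x" using a less.prems by simp
    qed
    let ?x = "a * x - (a * a - 1) * y" and ?y = "a * y - x"
    have "nat ?y < nat y" using x_gt x_le y by (simp add: algebra_simps)
    moreover have "?x * ?x = 1 + (a * a - 1) * (?y * ?y)"
    proof -
      have "?x * ?x - (a * a - 1) * (?y * ?y) = x * x - (a * a - 1) * (y * y)"
        by (simp add: algebra_simps)
      then show ?thesis using eq by simp
    qed
    ultimately obtain n where "?x = pX a n" "?y = pY a n"
      using less.hyps[of ?y ?x] x_ge x_le by auto
    then have "x = pX a (Suc n)" "y = pY a (Suc n)"
      by (simp_all flip: \<open>?x = pX a n\<close> \<open>?y = pY a n\<close>) (simp_all add: algebra_simps)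
    then show ?thesis by blast
  qed
qed

section \<open>Congruences and periodicity of Pell solutions\<close>

lemma pY_cong_index: "[pY a n = int n] (mod a - 1)"
proof -
  have "[pX a n = 1] (mod a - 1) \<and> [pY a n = int n] (mod a - 1)"
  proof (induction n)
    case (Suc n)
    \<comment> \<open>Modulo \<open>a - 1\<close> the recursion degenerates: the first component
      stays 1 and the second grows by 1 in each step.\<close>
    have a1: "[a = 1] (mod a - 1)" by (simp add: cong_iff_dvd_diff)
    have a0: "[a * a - 1 = 0] (mod a - 1)"
      unfolding cong_0_iff by (intro dvdI[of _ _ "a + 1"]) (simp add: algebra_simps)
    have "[a * pX a n + (a * a - 1) * pY a n = 1 * 1 + 0 * int n] (mod a - 1)"
      using Suc a1 a0 by (intro cong_add cong_mult) auto
    moreover have "[pX a n + a * pY a n = 1 + 1 * int n] (mod a - 1)"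
      using Suc a1 by (intro cong_add cong_mult) auto
    ultimately show ?case by simp
  qed simp
  then show ?thesis by simp
qed

lemma pell_cong_base:
  assumes "[a = b] (mod m)"
  shows "[pX a n = pX b n] (mod m) \<and> [pY a n = pY b n] (mod m)"
proof (induction n)
  case (Suc n)
  then show ?case using assms
    by (auto intro!: cong_add cong_mult cong_diff)
qed simp

text \<open>Modulo \<open>pX a n\<close> the power with exponent \<open>2 * n\<close> is
  \<open>-1\<close>: its components are \<open>2 * pX a n ^ 2 - 1\<close> and
  \<open>2 * pX a n * pY a n\<close>.\<close>

lemma pX_double_cong:
  "[pX a (2 * n + j) = - pX a j] (mod pX a n)"
  "j \<le> 2 * n \<Longrightarrow> [pX a (2 * n - j) = - pX a j] (mod pX a n)"
proof -
  have X2: "pX a (2 * n) = 2 * (pX a n * pX a n) - 1"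
    using pX_add[of a n n] pell_eq[of a n] by (simp flip: mult_2)
  have Y2: "pY a (2 * n) = 2 * (pX a n * pY a n)"
    using pY_add[of a n n] by (simp flip: mult_2)
  have "pX a (2 * n + j) - - pX a j =
      pX a n * (2 * (pX a n * pX a j) + (a * a - 1) * (2 * pY a n * pY a j))"
    unfolding pX_add X2 Y2 by (simp add: algebra_simps)
  then show "[pX a (2 * n + j) = - pX a j] (mod pX a n)"
    unfolding cong_iff_dvd_diff by (rule dvdI)
  assume "j \<le> 2 * n"
  then have "2 * n - j + j = 2 * n" by simp
  then have "pX a (2 * n - j) = pX a (2 * n) * pX a j - (a * a - 1) * (pY a (2 * n) * pY a j)"
    using pX_diff[of a "2 * n - j" j] by simp
  then have "pX a (2 * n - j) - - pX a j =
      pX a n * (2 * (pX a n * pX a j) - (a * a - 1) * (2 * pY a n * pY a j))"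
    unfolding X2 Y2 by (simp add: algebra_simps)
  then show "[pX a (2 * n - j) = - pX a j] (mod pX a n)"
    unfolding cong_iff_dvd_diff by (rule dvdI)
qed

lemma pX_period: "[pX a (4 * n * q + j) = pX a j] (mod pX a n)"
proof (induction q)
  case (Suc q)
  have "[pX a (2 * n + (2 * n + (4 * n * q + j))) = - (- pX a (4 * n * q + j))] (mod pX a n)"
    by (rule cong_trans[OF pX_double_cong(1)]) (simp only: cong_minus_minus_iff pX_double_cong(1))
  then have "[pX a (4 * n * Suc q + j) = pX a (4 * n * q + j)] (mod pX a n)"
    by (simp add: algebra_simps)
  then show ?case using Suc by (rule cong_trans)
qed simp

text \<open>All values with index up to \<open>n\<close> lie between 1 and the modulus, so two of
  them differ by less than the modulus.\<close>

lemma pX_cong_unique: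
  assumes a: "a \<ge> 2" and "i \<le> n" "r \<le> n" and c: "[pX a r = pX a i] (mod pX a n)"
  shows "r = i"
proof -
  have "1 \<le> pX a i" "1 \<le> pX a r" "pX a i \<le> pX a n" "pX a r \<le> pX a n"
    using pell_pos[OF a] pX_strict_mono[OF a] assms by (auto simp: strict_mono_less_eq)
  then have "\<bar>pX a r - pX a i\<bar> < pX a n" by linarith
  moreover have "pX a n dvd pX a r - pX a i" using c by (simp add: cong_iff_dvd_diff)
  ultimately have "pX a r - pX a i = 0"
    using dvd_imp_le_int[of "pX a r - pX a i" "pX a n"] by linarith
  then show ?thesis using strict_mono_eq[OF pX_strict_mono[OF a]] by simp
qed

text \<open>For \<open>n \<ge> 2\<close> the modulus is more than twice \<open>pX a (n - 1)\<close>,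
  so the sum of two values with index below \<open>n\<close> is too small to be a multiple. The
  condition \<open>0 < i\<close> excludes \<open>pX 2 0 + pX 2 0 = pX 2 1\<close>.\<close>

lemma pX_not_cong_minus:
  assumes a: "a \<ge> 2" and "0 < i" "i \<le> n" "l < n" and c: "[pX a i = - pX a l] (mod pX a n)"
  shows False
proof -
  have dvd: "pX a n dvd pX a i + pX a l" using c by (simp add: cong_iff_dvd_diff)
  have pos: "1 \<le> pX a i" "1 \<le> pX a l" using pell_pos[OF a] by auto
  obtain m where n: "n = Suc m" using \<open>l < n\<close> by (cases n) auto
  have l: "pX a l \<le> pX a m"
    using \<open>l < n\<close> pX_strict_mono[OF a] by (simp add: n strict_mono_less_eq)
  show False
  proof (cases "i = n")
    case True
    then have "pX a n dvd pX a l" using dvd by simp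
    then have "pX a n \<le> pX a l" using pos by (intro zdvd_imp_le) auto
    then show False using l pX_strict_Suc[OF a, of m] by (simp add: n)
  next
    case False
    then have i: "pX a i \<le> pX a m"
      using \<open>i \<le> n\<close> pX_strict_mono[OF a] by (simp add: n strict_mono_less_eq)
    have "0 < m" using False \<open>i \<le> n\<close> \<open>0 < i\<close> n by simp
    then have "0 < pY a m" using strict_monoD[OF pY_strict_mono[OF a], of 0 m] by simp
    moreover have "a * a \<ge> 2 * 2" using a by (intro mult_mono) auto
    ultimately have "0 < (a * a - 1) * pY a m" by simp
    moreover have "2 * pX a m \<le> a * pX a m"
      using a pell_pos[OF a, of m] by (intro mult_right_mono) auto
    ultimately have "pX a i + pX a l < pX a n" using i l by (simp add: n)
    moreover have "pX a n \<le> pX a i + pX a l" using dvd pos by (intro zdvd_imp_le) auto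
    ultimately show False by simp
  qed
qed

text \<open>Only \<open>r = j mod (4 * n)\<close> matters. In the outer quarters of the period the
  values are those of an index up to \<open>n\<close>; in the inner quarters they are negatives of
  values with index below \<open>n\<close>, which cannot be congruent to
  \<open>pX a i\<close>.\<close>

lemma pX_step_down:
  assumes a: "a \<ge> 2" and i: "0 < i" "i \<le> n" and c: "[pX a j = pX a i] (mod pX a n)"
  shows "[int j = int i] (mod 4 * int n) \<or> [int j = - int i] (mod 4 * int n)"
proof -
  define r where "r = j mod (4 * n)"
  have n: "0 < n" using i by simp
  have j: "4 * n * (j div (4 * n)) + r = j" by (simp add: r_def)
  have r4: "r < 4 * n" using n by (simp add: r_def)
  have "[pX a j = pX a r] (mod pX a n)" using pX_period[of a n "j div (4 * n)" r] by (simp only: j)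
  then have c': "[pX a r = pX a i] (mod pX a n)" using c by (metis cong_sym cong_trans)
  have jr: "[int j = int r] (mod 4 * int n)"
    by (simp add: r_def zmod_int cong_def)
  consider "r \<le> n" | "n < r" "r \<le> 2 * n" | "2 * n < r" "r < 3 * n" | "3 * n \<le> r" by linarith
  then show ?thesis
  proof cases
    case 1
    then have "r = i" using pX_cong_unique[OF a i(2) _ c'] by simp
    then show ?thesis using jr by simp
  next
    case 2
    then have "[pX a r = - pX a (2 * n - r)] (mod pX a n)"
      using pX_double_cong(2)[of "2 * n - r" n a] by simp
    then have "[pX a i = - pX a (2 * n - r)] (mod pX a n)" using c' by (metis cong_sym cong_trans)
    moreover have "2 * n - r < n" using 2 by linarith
    ultimately show ?thesis using pX_not_cong_minus[OF a i] by blast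
  next
    case 3
    then have "[pX a r = - pX a (r - 2 * n)] (mod pX a n)"
      using pX_double_cong(1)[of a n "r - 2 * n"] by simp
    then have "[pX a i = - pX a (r - 2 * n)] (mod pX a n)" using c' by (metis cong_sym cong_trans)
    moreover have "r - 2 * n < n" using 3 by linarith
    ultimately show ?thesis using pX_not_cong_minus[OF a i] by blast
  next
    case 4
    have "[pX a r = - pX a (r - 2 * n)] (mod pX a n)"
      using pX_double_cong(1)[of a n "r - 2 * n"] 4 by simp
    moreover have "[pX a (2 * n - (r - 2 * n)) = - pX a (r - 2 * n)] (mod pX a n)"
      using r4 by (intro pX_double_cong(2)) linarith
    moreover have "2 * n - (r - 2 * n) = 4 * n - r" using 4 r4 by linarith
    ultimately have "[pX a (4 * n - r) = pX a i] (mod pX a n)"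
      using c' by (metis cong_sym cong_trans)
    then have "4 * n - r = i" using pX_cong_unique[OF a i(2)] 4 by simp
    then have "int r = 4 * int n - int i" using r4 by linarith
    then have "[int r = - int i] (mod 4 * int n)" by (simp add: cong_iff_dvd_diff)
    then show ?thesis using jr cong_trans by blast
  qed
qed

section \<open>Divisibility between Pell solutions\<close>

lemma coprime_pell: "coprime (pX a n) (pY a n)"
proof (rule coprimeI)
  fix c assume "c dvd pX a n" "c dvd pY a n"
  then have "c dvd pX a n * pX a n - (a * a - 1) * (pY a n * pY a n)"
    by (intro dvd_diff) auto
  then show "is_unit c" by (simp add: pell_eq)
qed

lemma pY_dvd_mult: "pY a i dvd pY a (i * q)"
proof (induction q)
  case (Suc q)
  then show ?case by (simp add: pY_add)
qed simp

text \<open>The binomial expansion of the \<open>q\<close>-th power keeps only its first two terms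
  modulo \<open>pY a i ^ 2\<close>. The factor \<open>pX a i\<close> in the second congruence avoids
  the exponent \<open>q - 1\<close>.\<close>

lemma pell_mult_cong:
  "[pX a (i * q) = pX a i ^ q] (mod pY a i ^ 2) \<and>
   [pX a i * pY a (i * q) = int q * pX a i ^ q * pY a i] (mod pY a i ^ 2)"
proof (induction q)
  case (Suc q)
  have z: "[(a * a - 1) * (pY a i * pY a (i * q)) = 0] (mod pY a i ^ 2)"
    using pY_dvd_mult[of a i q] by (simp add: cong_0_iff power2_eq_square)
  have "[pX a i * pX a (i * q) + (a * a - 1) * (pY a i * pY a (i * q)) =
      pX a i * pX a i ^ q + 0] (mod pY a i ^ 2)"
    using Suc z by (intro cong_add cong_scalar_left) auto
  moreover have "[pX a i * (pX a i * pY a (i * q)) + pX a i * (pX a (i * q) * pY a i) =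
      pX a i * (int q * pX a i ^ q * pY a i) + pX a i * (pX a i ^ q * pY a i)] (mod pY a i ^ 2)"
    using Suc by (intro cong_add cong_scalar_left cong_scalar_right) auto
  ultimately show ?case by (simp add: pX_add pY_add algebra_simps)
qed simp

text \<open>Division of \<open>n\<close> by \<open>i\<close> with remainder \<open>r\<close> leaves
  \<open>pY a i\<close> dividing \<open>pY a r\<close>, which is smaller, because the cofactor is
  coprime to \<open>pY a i\<close>.\<close>

lemma pY_dvd_imp_dvd:
  assumes a: "a \<ge> 2" and i: "0 < i" and d: "pY a i dvd pY a n"
  shows "i dvd n"
proof -
  define r where "r = n mod i"
  have n: "n = i * (n div i) + r" by (simp add: r_def)
  have "pY a n = pX a (i * (n div i)) * pY a r + pY a (i * (n div i)) * pX a r"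
    by (subst n) (rule pY_add)
  then have "pY a i dvd pX a (i * (n div i)) * pY a r"
    using d dvd_add_left_iff[OF dvd_mult2[OF pY_dvd_mult[of a i "n div i"]]] by simp
  moreover have "coprime (pY a i) (pX a (i * (n div i)))"
    by (rule coprime_divisors[OF pY_dvd_mult[of a i "n div i"] dvd_refl])
      (use coprime_pell in \<open>simp add: coprime_commute\<close>)
  ultimately have "pY a i dvd pY a r" by (simp add: coprime_dvd_mult_right_iff)
  moreover have "pY a r < pY a i"
    using i strict_monoD[OF pY_strict_mono[OF a]] by (simp add: r_def)
  ultimately have "pY a r = 0" using pell_pos[OF a, of r] zdvd_not_zless[of "pY a r" "pY a i"] by linarith
  then have "r = 0" using pY_ge_index[OF a, of r] by simp
  then show ?thesis by (simp add: r_def mod_eq_0_iff_dvd)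
qed

text \<open>For \<open>n = i * q\<close> the expansion modulo the square makes \<open>pY a i\<close>
  divide \<open>q\<close>. Divisibility between solutions thus controls the index \<open>n\<close>,
  and with it the period \<open>4 * n\<close> of congruences.\<close>

lemma pY_square_dvd_imp_dvd:
  assumes a: "a \<ge> 2" and i: "0 < i" and d: "pY a i ^ 2 dvd pY a n"
  shows "pY a i dvd int n"
proof -
  have "pY a i dvd pY a n" using d by (metis dvd_triv_left dvd_trans power2_eq_square)
  then obtain q where n: "n = i * q" using pY_dvd_imp_dvd[OF a i] by blast
  have "pY a i ^ 2 dvd pX a i * pY a (i * q)" using d n by simp
  then have "pY a i ^ 2 dvd int q * pX a i ^ q * pY a i"
    using cong_dvd_iff[OF pell_mult_cong[THEN conjunct2]] by simp
  moreover have "0 < pY a i" using pY_ge_index[OF a, of i] i by linarith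
  ultimately have "pY a i dvd int q * pX a i ^ q" by (simp add: power2_eq_square)
  moreover have "coprime (pY a i) (pX a i ^ q)"
    using coprime_pell[of a i] by (simp add: coprime_commute)
  ultimately have "pY a i dvd int q" by (simp add: coprime_dvd_mult_left_iff)
  then show ?thesis by (simp add: n)
qed

lemma pY_square_dvd:
  assumes "a \<ge> 2"
  shows "pY a i ^ 2 dvd pY a (i * nat (pY a i))"
proof -
  have "int (nat (pY a i)) = pY a i" using pell_pos[OF assms] by simp
  then have "[pX a i * pY a (i * nat (pY a i)) = pY a i * pX a i ^ nat (pY a i) * pY a i] (mod pY a i ^ 2)"
    using pell_mult_cong[of a i "nat (pY a i)"] by simp
  from cong_dvd_iff[OF this] have "pY a i ^ 2 dvd pX a i * pY a (i * nat (pY a i))"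
    by (simp add: power2_eq_square mult.assoc mult.left_commute)
  moreover have "coprime (pY a i ^ 2) (pX a i)"
    using coprime_pell[of a i] by (simp add: coprime_commute)
  ultimately show ?thesis by (simp add: coprime_dvd_mult_right_iff)
qed

section \<open>Exponentiation is Diophantine\<close>

lemma pell_nat_iff:
  assumes "a \<ge> 2"
  shows "x * x + y * y = a * a * (y * y) + 1 \<longleftrightarrow> (\<exists>n. int x = pX (int a) n \<and> int y = pY (int a) n)"
proof -
  have "x * x + y * y = a * a * (y * y) + 1 \<longleftrightarrow>
      int x * int x + int y * int y = int a * int a * (int y * int y) + 1"
    by (subst of_nat_eq_iff[where 'a = int, symmetric]) (simp add: add.commute)
  also have "\<dots> \<longleftrightarrow> int x * int x = 1 + (int a * int a - 1) * (int y * int y)"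
    by (auto simp: algebra_simps)
  also have "\<dots> \<longleftrightarrow> (\<exists>n. int x = pX (int a) n \<and> int y = pY (int a) n)"
    using pell_complete[of "int a" "int x" "int y"] pell_eq[of "int a"] assms by auto
  finally show ?thesis .
qed

definition YY :: "nat \<Rightarrow> nat \<Rightarrow> nat" where
  "YY a n = nat (pY (int a) n)"

definition XX :: "nat \<Rightarrow> nat \<Rightarrow> nat" where
  "XX a n = nat (pX (int a) n)"

lemma int_YY: "a \<ge> 2 \<Longrightarrow> int (YY a n) = pY (int a) n"
  using pell_pos[of "int a" n] by (simp add: YY_def)

lemma int_XX: "a \<ge> 2 \<Longrightarrow> int (XX a n) = pX (int a) n"
  using pell_pos[of "int a" n] by (simp add: XX_def)

lemma XX_YY: "a \<ge> 2 \<Longrightarrow> XX a n * XX a n + YY a n * YY a n = a * a * (YY a n * YY a n) + 1"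
  unfolding pell_nat_iff by (auto simp: int_YY int_XX)

text \<open>Matiyasevich's system: the index of a solution of the Pell equation is recovered from a
  second solution in a base that is congruent both to 1 and to the original base.\<close>
lemma YY_iff:
  assumes a: "a \<ge> 2" and k: "0 < k"
  shows "y = YY a k \<longleftrightarrow> k \<le> y \<and> (\<exists>x u v s t b.
    x * x + y * y = a * a * (y * y) + 1 \<and> u * u + v * v = a * a * (v * v) + 1 \<and>
    s * s + t * t = b * b * (t * t) + 1 \<and> 2 \<le> b \<and> [b = 1] (mod 4 * y) \<and> [b = a] (mod u) \<and>
    0 < v \<and> y * y dvd v \<and> [s = x] (mod u) \<and> [t = k] (mod 4 * y))" (is "_ \<longleftrightarrow> _ \<and> (\<exists>x u v s t b. ?S x u v s t b)")
proof
  assume y: "y = YY a k"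
  have ia: "int a \<ge> 2" using a by simp
  have ky: "k \<le> y" using pY_ge_index[OF ia, of k] int_YY[OF a, of k] y by linarith
  then have y0: "0 < y" using k by simp
  \<comment> \<open>The index \<open>k * y\<close> makes \<open>y * y\<close> divide
    \<open>v\<close>; doubling it makes \<open>v\<close> even, hence \<open>u\<close> odd and
    coprime to \<open>4 * y\<close>, as the Chinese remainder theorem requires.\<close>
  define n where "n = 2 * (k * y)"
  define u where "u = XX a n"
  define v where "v = YY a n"
  have n: "0 < n" using k y0 by (simp add: n_def)
  have uv: "u * u + v * v = a * a * (v * v) + 1" by (simp add: u_def v_def XX_YY[OF a])
  have v0: "0 < v" using pY_ge_index[OF ia, of n] int_YY[OF a, of n] n by (simp add: v_def)
  have "pY (int a) (k * y) dvd pY (int a) (k * y * 2)" by (rule pY_dvd_mult)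
  moreover have "pY (int a) k ^ 2 dvd pY (int a) (k * y)"
    using pY_square_dvd[OF ia, of k] by (simp add: y YY_def)
  ultimately have "pY (int a) k ^ 2 dvd pY (int a) (k * y * 2)" by (metis dvd_trans)
  moreover have "int v = pY (int a) (k * y * 2)"
    unfolding v_def int_YY[OF a] n_def by (simp only: mult.commute)
  moreover have "int y = pY (int a) k" unfolding y by (rule int_YY[OF a])
  ultimately have "int y ^ 2 dvd int v" by simp
  then have yv: "y * y dvd v" by (simp add: power2_eq_square flip: of_nat_mult)
  have "int v = 2 * (pX (int a) (k * y) * pY (int a) (k * y))"
    unfolding v_def int_YY[OF a] n_def mult_2 pY_add by simp
  then have "even (int v)" by simp
  then have "even v" by simp
  then have "odd u" using arg_cong[OF uv, of even] by simp
  moreover have cop: "coprime u v"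
    using coprime_pell[of "int a" n] by (simp add: u_def v_def int_XX[OF a, symmetric] int_YY[OF a, symmetric])
  ultimately have "coprime u (4 * y)"
    using coprime_divisors[OF dvd_refl dvd_mult_left[OF yv] cop] coprime_power_right_iff[of u 2 2]
    by (simp add: coprime_right_2_iff_odd coprime_mult_right_iff)
  then obtain b0 where b0: "[b0 = a] (mod u)" "[b0 = 1] (mod 4 * y)"
    using binary_chinese_remainder_nat by blast
  have u0: "0 < u" using \<open>odd u\<close> odd_pos by blast
  \<comment> \<open>Adding the product of the two moduli keeps both congruences and ensures
    \<open>2 \<le> b\<close>.\<close>
  define b where "b = b0 + u * (4 * y)"
  have "1 * 4 \<le> u * (4 * y)" using u0 y0 by (intro mult_mono) auto
  then have b2: "2 \<le> b" unfolding b_def by linarith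
  have b: "[b = a] (mod u)" "[b = 1] (mod 4 * y)"
    using b0 unfolding b_def by (simp_all add: cong_def)
  have ib: "[int b = int a] (mod int u)" "[int b = 1] (mod 4 * int y)"
    using b by (simp_all flip: cong_int_iff)
  have "[int (XX b k) = int (XX a k)] (mod int u)"
    unfolding int_XX[OF a] int_XX[OF b2] using pell_cong_base[OF ib(1)] by blast
  then have s: "[XX b k = XX a k] (mod u)" by (simp only: cong_int_iff)
  have "4 * int y dvd int b - 1" using ib(2) by (simp add: cong_iff_dvd_diff)
  then have "[int (YY b k) = int k] (mod 4 * int y)"
    unfolding int_YY[OF b2] by (rule cong_dvd_modulus[OF pY_cong_index])
  then have t: "[YY b k = k] (mod 4 * y)" by (simp flip: cong_int_iff)
  have "?S (XX a k) u v (XX b k) (YY b k) b"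
    using XX_YY[OF a, of k] XX_YY[OF b2, of k] uv v0 yv s t b b2 y by blast
  then show "k \<le> y \<and> (\<exists>x u v s t b. ?S x u v s t b)" using ky by blast
next
  assume "k \<le> y \<and> (\<exists>x u v s t b. ?S x u v s t b)"
  then obtain x u v s t b where ky: "k \<le> y" and S: "?S x u v s t b" by blast
  have ia: "int a \<ge> 2" using a by simp
  have b: "2 \<le> b" using S by blast
  have y0: "0 < y" using ky k by simp
  obtain i where i: "int x = pX (int a) i" "int y = pY (int a) i"
    using S pell_nat_iff[OF a] by blast
  obtain n where n: "int u = pX (int a) n" "int v = pY (int a) n"
    using S pell_nat_iff[OF a] by blast
  obtain j where j: "int s = pX (int b) j" "int t = pY (int b) j"
    using S pell_nat_iff[OF b] by blast
  have ib: "[int b = int a] (mod int u)" "[int b = 1] (mod 4 * int y)" "[int s = int x] (mod int u)"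
    "[int t = int k] (mod 4 * int y)"
    using S by (simp_all flip: cong_int_iff)
  have i0: "0 < i" using i(2) y0 by (cases i) auto
  have v0: "0 < v" and yv: "y * y dvd v" using S by blast+
  have "y * y \<le> v" using yv v0 by (rule dvd_imp_le)
  moreover have "y \<le> y * y" by simp
  ultimately have "y \<le> v" by linarith
  then have "pY (int a) i \<le> pY (int a) n" using i n by simp
  then have i_n: "i \<le> n" using strict_mono_less_eq[OF pY_strict_mono[OF ia]] by blast
  \<comment> \<open>Modulo \<open>u\<close> the base \<open>b\<close> may be replaced by
    \<open>a\<close>, which relates the index \<open>j\<close> to \<open>i\<close>; modulo
    \<open>4 * y\<close> the base is 1, which relates \<open>j\<close> to \<open>k\<close>.\<close>
  have "[pX (int b) j = pX (int a) j] (mod pX (int a) n)"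
    using pell_cong_base[OF ib(1)] n by simp
  moreover have "[pX (int b) j = pX (int a) i] (mod pX (int a) n)"
    using ib(3) i j n by simp
  ultimately have "[pX (int a) j = pX (int a) i] (mod pX (int a) n)"
    by (metis cong_sym cong_trans)
  then have ji: "[int j = int i] (mod 4 * int n) \<or> [int j = - int i] (mod 4 * int n)"
    by (rule pX_step_down[OF ia i0 i_n])
  have "pY (int a) i ^ 2 dvd pY (int a) n"
    using yv unfolding i(2)[symmetric] n(2)[symmetric] by (simp add: power2_eq_square flip: of_nat_mult)
  then have "int y dvd int n" using pY_square_dvd_imp_dvd[OF ia i0] i by simp
  then have yn: "4 * int y dvd 4 * int n" by simp
  have ji': "[int j = int i] (mod 4 * int y) \<or> [int j = - int i] (mod 4 * int y)"
    using ji cong_dvd_modulus[OF _ yn] by blast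
  have "4 * int y dvd int b - 1" using ib(2) by (simp add: cong_iff_dvd_diff)
  then have "[int t = int j] (mod 4 * int y)"
    unfolding j by (rule cong_dvd_modulus[OF pY_cong_index])
  then have kj: "[int k = int j] (mod 4 * int y)" using ib(4) by (metis cong_sym cong_trans)
  \<comment> \<open>Both \<open>k\<close> and \<open>i\<close> lie between 1 and \<open>y\<close>,
    so modulo \<open>4 * y\<close> they are congruent only if equal, and \<open>k + i\<close> is
    never 0.\<close>
  have iy: "int i \<le> int y" using pY_ge_index[OF ia, of i] i by simp
  have "k = i"
  proof (rule disjE[OF ji'])
    assume "[int j = int i] (mod 4 * int y)"
    then have "[int k = int i] (mod 4 * int y)" using kj cong_trans by blast
    then have "4 * int y dvd int k - int i" by (simp add: cong_iff_dvd_diff)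
    then show "k = i"
      using dvd_imp_le_int[of "int k - int i" "4 * int y"] iy ky y0 by linarith
  next
    assume "[int j = - int i] (mod 4 * int y)"
    then have "[int k = - int i] (mod 4 * int y)" using kj cong_trans by blast
    then have "4 * int y dvd int k + int i" by (simp add: cong_iff_dvd_diff)
    then show "k = i"
      using dvd_imp_le_int[of "int k + int i" "4 * int y"] iy ky y0 by linarith
  qed
  then show "y = YY a k" using i by (simp add: YY_def flip: i(2))
qed

text \<open>The shift by 2 builds the bound on the base into the term, so that the closure rule has
  no side condition. Index 0 becomes a separate alternative.\<close>

lemma dfun_YY [dio]:
  assumes "dfun f" "dfun g"
  shows "dfun (\<lambda>v. YY (f v + 2) (g v))"
proof -
  define R where "R a k y \<longleftrightarrow> (\<exists>x u v s t b.
      x * x + y * y = a * a * (y * y) + 1 \<and> u * u + v * v = a * a * (v * v) + 1 \<and>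
      s * s + t * t = b * b * (t * t) + 1 \<and> 2 \<le> b \<and> [b = 1] (mod 4 * y) \<and> [b = a] (mod u) \<and>
      0 < v \<and> y * y dvd v \<and> [s = x] (mod u) \<and> [t = k] (mod 4 * y))" for a k y :: nat
  have "y = YY (c + 2) k \<longleftrightarrow> k = 0 \<and> y = 0 \<or> 0 < k \<and> k \<le> y \<and> R (c + 2) k y" for y c k
    using YY_iff[of "c + 2" k y, folded R_def] by (cases "k = 0") (simp_all add: YY_def)
  then have "dioph (\<lambda>v. v 0 = YY (v 1 + 2) (v 2))" by (simp only: R_def) (intro dio)
  then show ?thesis by (rule dfunI2[where F = "\<lambda>c k. YY (c + 2) k", OF assms])
qed

text \<open>For this modulus \<open>a - k\<close> is a square root of \<open>a * a - 1\<close>, so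
  the left side is the \<open>n\<close>-th power of \<open>a - (a - k) = k\<close>.\<close>

lemma pell_power_cong:
  "[pX a n - pY a n * (a - k) = k ^ n] (mod 2 * a * k - k * k - 1)"
proof (induction n)
  case (Suc n)
  have "pX a (Suc n) - pY a (Suc n) * (a - k) =
      k * (pX a n - pY a n * (a - k)) + (2 * a * k - k * k - 1) * pY a n"
    by (simp add: algebra_simps)
  then have "[pX a (Suc n) - pY a (Suc n) * (a - k) = k * (pX a n - pY a n * (a - k))]
      (mod 2 * a * k - k * k - 1)"
    by (simp add: cong_iff_dvd_diff del: pX.simps pY.simps)
  moreover have "[k * (pX a n - pY a n * (a - k)) = k * k ^ n] (mod 2 * a * k - k * k - 1)"
    using Suc by (rule cong_scalar_left)
  ultimately show ?case using cong_trans by (simp del: pX.simps pY.simps) blast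
qed simp

text \<open>A residue modulo \<open>t\<close> determines \<open>m ^ n\<close> once \<open>t\<close>
  exceeds it. The large base \<open>a\<close> that this takes cannot be named by a power yet; the
  exponential growth of \<open>YY\<close> supplies it.\<close>

lemma power_nat_iff:
  assumes m: "0 < m" and a: "a = YY (m + 2) (n + 2) + 2"
  shows "r = m ^ n \<longleftrightarrow> (\<exists>x t. x * x + YY a n * YY a n = a * a * (YY a n * YY a n) + 1 \<and>
    t + m * m + 1 = 2 * a * m \<and> r < t \<and> [x + YY a n * m = YY a n * a + r] (mod t))"
    (is "_ \<longleftrightarrow> (\<exists>x t. ?S x t)")
proof -
  have a2: "2 \<le> a" by (simp add: a)
  have "int (m + 2) ^ (n + 1) \<le> int (YY (m + 2) (n + 2))"
    using pY_ge_power[of "int (m + 2)" "n + 1"] int_YY[of "m + 2" "n + 2"] by simp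
  then have YY: "(m + 2) ^ (n + 1) \<le> YY (m + 2) (n + 2)"
    by (simp only: of_nat_power[symmetric] of_nat_le_iff)
  have "(m + 2) * 1 \<le> (m + 2) * (m + 2) ^ n" by (intro mult_left_mono) auto
  then have am: "m + 4 \<le> a" using YY by (simp add: a)
  have "m ^ n \<le> (m + 2) ^ n" by (intro power_mono) auto
  also have "\<dots> \<le> (m + 2) * (m + 2) ^ n" by simp
  finally have an: "m ^ n < a" using YY by (simp add: a)
  define t where "t = 2 * a * m - m * m - 1"
  have "(m + 4) * m \<le> a * m" using am by (intro mult_right_mono) auto
  then have mm: "m * m + 1 \<le> a * m" using m by (simp add: algebra_simps)
  have t: "t + m * m + 1 = 2 * a * m" using mm by (simp add: t_def algebra_simps)
  have "a * 1 \<le> a * m" using m by (intro mult_left_mono) auto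
  moreover have "t + m * m + 1 = a * m + a * m" using t by (simp add: algebra_simps)
  ultimately have rt: "m ^ n < t" using an mm by linarith
  have it: "int t = 2 * int a * int m - int m * int m - 1"
    using arg_cong[OF t, of int] by (simp add: algebra_simps)
  have "[int (XX a n) - int (YY a n) * (int a - int m) = int m ^ n] (mod int t)"
    unfolding it int_XX[OF a2] int_YY[OF a2] by (rule pell_power_cong)
  then have "[int (XX a n) + int (YY a n) * int m = int (YY a n) * int a + int m ^ n] (mod int t)"
    by (simp add: cong_iff_dvd_diff algebra_simps)
  then have cong: "[XX a n + YY a n * m = YY a n * a + m ^ n] (mod t)"
    by (simp flip: cong_int_iff)
  have uniq: "x = XX a n" if "x * x + YY a n * YY a n = a * a * (YY a n * YY a n) + 1" for x
  proof -
    have "x * x = XX a n * XX a n" using that XX_YY[OF a2, of n] by linarith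
    then show ?thesis by (metis power2_eq_square power2_eq_iff_nonneg zero_le)
  qed
  show ?thesis
  proof
    assume "r = m ^ n"
    then show "\<exists>x t. ?S x t" using XX_YY[OF a2, of n] t rt cong by blast
  next
    assume "\<exists>x t. ?S x t"
    then obtain x t' where S: "?S x t'" by blast
    then have "t' = t" using t by linarith
    moreover have "x = XX a n" using uniq S by blast
    ultimately have "[YY a n * a + r = YY a n * a + m ^ n] (mod t)"
      using S cong by (metis cong_sym cong_trans)
    then have "[r = m ^ n] (mod t)" by (simp add: cong_add_lcancel_nat)
    then show "r = m ^ n" using S rt \<open>t' = t\<close> by (simp add: cong_def)
  qed
qed

lemma dfun_power [dio]:
  assumes "dfun f" "dfun g"
  shows "dfun (\<lambda>v. f v ^ g v)"
proof (rule dfunI2[OF assms])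
  define R where "R m r a y \<longleftrightarrow> (\<exists>x t. x * x + y * y = a * a * (y * y) + 1 \<and>
      t + m * m + 1 = 2 * a * m \<and> r < t \<and> [x + y * m = y * a + r] (mod t))" for m r a y :: nat
  have "r = m ^ n \<longleftrightarrow> m = 0 \<and> n = 0 \<and> r = 1 \<or> m = 0 \<and> 0 < n \<and> r = 0 \<or>
      0 < m \<and> R m r (YY (m + 2) (n + 2) + 2) (YY (YY (m + 2) (n + 2) + 2) n)" for r m n :: nat
    using power_nat_iff[of m "YY (m + 2) (n + 2) + 2" n r, folded R_def]
    by (cases "m = 0"; cases "n = 0") (simp_all add: zero_power)
  then show "dioph (\<lambda>v. v 0 = v 1 ^ v 2)" by (simp only: R_def) (intro dio)
qed

section \<open>Bounded universal quantification\<close>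

lemma digit_extract:
  assumes "\<And>i. d i < z" and "k < n"
  shows "(\<Sum>i<n. d i * z ^ i) div z ^ k mod z = (d k :: nat)"
  using assms
proof (induction k arbitrary: d n)
  case (0 d n)
  then obtain m where n: "n = Suc m" by (cases n) auto
  have "(\<Sum>i<n. d i * z ^ i) = d 0 + z * (\<Sum>i<m. d (Suc i) * z ^ i)"
    by (simp only: n sum.lessThan_Suc_shift) (simp add: sum_distrib_left mult_ac)
  then show ?case using 0 by simp
next
  case (Suc k d n)
  then obtain m where n: "n = Suc m" by (cases n) auto
  have "(\<Sum>i<n. d i * z ^ i) = d 0 + z * (\<Sum>i<m. d (Suc i) * z ^ i)"
    by (simp only: n sum.lessThan_Suc_shift) (simp add: sum_distrib_left mult_ac)
  moreover have "0 < z" using Suc.prems(1)[of 0] by simp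
  ultimately have "(\<Sum>i<n. d i * z ^ i) div z = (\<Sum>i<m. d (Suc i) * z ^ i)"
    using Suc.prems(1)[of 0] by simp
  then have "(\<Sum>i<n. d i * z ^ i) div z ^ Suc k = (\<Sum>i<m. d (Suc i) * z ^ i) div z ^ k"
    by (simp add: div_mult2_eq)
  then show ?case using Suc.IH[of "\<lambda>i. d (Suc i)" m] Suc.prems n by simp
qed

text \<open>The binomial theorem is read as an expansion in base \<open>2 ^ n + 1\<close>, in which
  every coefficient, being at most \<open>2 ^ n\<close>, is a digit.\<close>

lemma binomial_eq_digit: "n choose k = (1 + (2 ^ n + 1)) ^ n div (2 ^ n + 1) ^ k mod (2 ^ n + 1)"
proof -
  define z :: nat where "z = 2 ^ n + 1"
  have "(1 + z) ^ n = (\<Sum>i\<le>n. (n choose i) * z ^ i)"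
    using binomial[of z 1 n] by (simp add: add.commute)
  \<comment> \<open>Padding with zero coefficients brings position \<open>k\<close> into range when
    \<open>k > n\<close>.\<close>
  also have "\<dots> = (\<Sum>i<Suc (n + k). (n choose i) * z ^ i)"
    by (rule sum.mono_neutral_left) auto
  finally have "(1 + z) ^ n = (\<Sum>i<Suc (n + k). (n choose i) * z ^ i)" .
  moreover have "(\<Sum>i<Suc (n + k). (n choose i) * z ^ i) div z ^ k mod z = n choose k"
    using binomial_le_pow2[of n] by (intro digit_extract) (auto simp: z_def less_Suc_eq_le)
  ultimately have "(1 + z) ^ n div z ^ k mod z = n choose k" by simp
  then show ?thesis by (simp add: z_def)
qed

lemma dfun_binomial [dio]: "dfun f \<Longrightarrow> dfun g \<Longrightarrow> dfun (\<lambda>v. f v choose g v)"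
  by (subst binomial_eq_digit) (intro dio)

lemma fact_times_binomial: "fact k * (n choose k) = (\<Prod>i<k. n - i)"
proof (induction k)
  case (Suc k)
  have "fact (Suc k) * (n choose Suc k) = fact k * (Suc k * (n choose Suc k))"
    by (simp only: fact_Suc of_nat_id mult_ac)
  also have "Suc k * (n choose Suc k) = (n - k) * (n choose k)"
    by (simp only: binomial_absorption binomial_absorb_comp)
  also have "fact k * ((n - k) * (n choose k)) = (n - k) * (fact k * (n choose k))" by simp
  finally show ?case by (simp add: Suc)
qed simp

text \<open>Each of the \<open>k\<close> factors falls short of \<open>r\<close> by at most
  \<open>k\<close>, so the product loses at most \<open>k * k * r ^ (k - 1)\<close>. Multiplication
  by \<open>r\<close> removes the exponent \<open>k - 1\<close>.\<close>

lemma falling_factorial_lower: "r * r ^ k \<le> r * (\<Prod>i<k. r - i) + k * k * r ^ k"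
proof (induction k)
  case (Suc k)
  let ?P = "\<Prod>i<k. r - i"
  have "?P \<le> (\<Prod>i<k. r)" by (intro prod_mono) auto
  then have "?P \<le> r ^ k" by simp
  then have k: "k * ?P \<le> k * r ^ k" by simp
  have "r * ?P \<le> (r - k + k) * ?P" by (intro mult_right_mono) auto
  also have "\<dots> = ?P * (r - k) + k * ?P" by (simp add: algebra_simps)
  finally have "r * ?P \<le> ?P * (r - k) + k * r ^ k" using k by linarith
  then have "r * (r * ?P) \<le> r * (?P * (r - k) + k * r ^ k)" by (rule mult_left_mono) simp
  moreover have "r * (r * r ^ k) \<le> r * (r * ?P + k * k * r ^ k)" using Suc by (rule mult_left_mono) simp
  moreover have "(k * k + k) * (r * r ^ k) \<le> Suc k * Suc k * (r * r ^ k)" by (intro mult_right_mono) auto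
  ultimately show ?case by (simp add: algebra_simps)
qed simp

text \<open>The exact quotient is \<open>n!\<close> times \<open>r ^ n\<close> over a falling
  factorial; for large \<open>r\<close> this ratio is so close to 1 that rounding down gives
  \<open>n!\<close>. How large depends on \<open>n!\<close>, which is replaced by its bound
  \<open>n ^ n\<close>.\<close>

lemma fact_eq_div:
  assumes r: "r = (n ^ n + 1) * (n * n) + 1"
  shows "fact n = r ^ n div (r choose n)"
proof -
  let ?F = "fact n :: nat" and ?P = "\<Prod>i<n. r - i"
  have P: "?F * (r choose n) = ?P" by (rule fact_times_binomial)
  have "?F \<le> n ^ n" using fact_le_power[of n, where 'a = nat] by simp
  then have "(?F + 1) * (n * n) \<le> (n ^ n + 1) * (n * n)" by (intro mult_right_mono) auto
  then have rn: "(?F + 1) * (n * n) < r" unfolding r by linarith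
  have rp: "0 < r ^ n" by (simp add: r)
  have "?F * r * r ^ n + (?F + 1) * (n * n) * r ^ n < ?F * r * r ^ n + r * r ^ n"
    using rn rp by simp
  also have "\<dots> = (?F + 1) * (r * r ^ n)" by (simp add: algebra_simps)
  also have "\<dots> \<le> (?F + 1) * (r * ?P + n * n * r ^ n)"
    by (intro mult_left_mono falling_factorial_lower) auto
  finally have "?F * r * r ^ n < (?F + 1) * (r * ?P)" by (simp add: algebra_simps)
  then have "r * (?F * r ^ n) < r * ((?F + 1) * ?P)" by (simp add: algebra_simps)
  then have "?F * r ^ n < (?F + 1) * ?P" by simp
  then have "?F * r ^ n < ?F * ((r choose n) * Suc ?F)" unfolding P[symmetric] by (simp add: algebra_simps)
  then have "r ^ n < (r choose n) * Suc ?F" by simp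
  moreover have "(r choose n) * ?F \<le> r ^ n" by (rule binomial_fact_pow)
  ultimately show ?thesis by (metis div_nat_eqI)
qed

lemma dfun_fact [dio]:
  assumes "dfun f"
  shows "dfun (\<lambda>v. fact (f v))"
  by (subst fact_eq_div[OF HOL.refl]) (intro dio assms)

section \<open>Chinese remainder coding of a bounded family of solutions\<close>

primrec exvars :: "pexp \<Rightarrow> nat set" where
  "exvars (Par i) = {}"
| "exvars (Unk i) = {i}"
| "exvars PZero = {}"
| "exvars POne = {}"
| "exvars (PAdd p q) = exvars p \<union> exvars q"
| "exvars (PMul p q) = exvars p \<union> exvars q"

lemma finite_exvars: "finite (exvars p)"
  by (induction p) auto

lemma pval_cong_mod:
  assumes "\<And>i. [v i = v' i] (mod m)" and "\<And>j. j \<in> exvars p \<Longrightarrow> [w j = w' j] (mod m)"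
  shows "[pval p v w = pval p v' w'] (mod (m :: nat))"
  using assms(2) by (induction p) (auto intro: cong_add cong_mult assms(1))

lemma pval_mono:
  assumes "\<And>i. v i \<le> v' i" and "\<And>j. j \<in> exvars p \<Longrightarrow> w j \<le> w' j"
  shows "pval p v w \<le> (pval p v' w' :: nat)"
  using assms(2) by (induction p) (auto intro: add_mono mult_mono assms(1))

text \<open>The moduli \<open>1 + Q / (k + 1)\<close> replace Goedel's \<open>1 + (k + 1) t\<close>: their product is a
  binomial coefficient, and \<open>k + 1\<close> is congruent to \<open>- Q\<close> modulo the \<open>k\<close>-th one.\<close>
locale moduli =
  fixes M Q :: nat and m :: "nat \<Rightarrow> nat"
  defines "Q \<equiv> (fact M)\<^sup>2" and "m \<equiv> \<lambda>k. 1 + Q div Suc k"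
begin

lemma Suc_dvd_fact: "k < M \<Longrightarrow> Suc k dvd fact M"
  by (rule dvd_fact) auto

lemma modulus_mult: "k < M \<Longrightarrow> Suc k * m k = Q + Suc k"
  using dvd_mult[OF Suc_dvd_fact[of k], of "fact M"]
  by (simp add: m_def Q_def power2_eq_square add_mult_distrib2 del: mult_Suc)

text \<open>Because \<open>Q\<close> is the square of a factorial, \<open>Q div Suc k\<close> still
  contains a full factor \<open>fact M\<close>; a prime up to \<open>M\<close> would divide it as
  well as \<open>m k\<close>, hence also 1.\<close>

lemma prime_dvd_modulus:
  assumes "k < M" "prime p" "p dvd m k"
  shows "M < p"
proof (rule ccontr)
  assume "\<not> M < p"
  then have "p dvd fact M" using assms(2) by (simp add: prime_dvd_fact_iff)
  moreover have "Q div Suc k = fact M * (fact M div Suc k)"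
    using Suc_dvd_fact[OF assms(1)] by (simp add: Q_def power2_eq_square div_mult_swap)
  ultimately have "p dvd Q div Suc k" by simp
  then have "p dvd 1" using assms(3) unfolding m_def by (simp only: dvd_add_left_iff)
  then show False using assms(2) by simp
qed

lemma modulus_coprime_small:
  assumes "k < M" "\<And>p. prime p \<Longrightarrow> p dvd n \<Longrightarrow> p \<le> M"
  shows "coprime (m k) n"
proof (rule ccontr)
  assume "\<not> coprime (m k) n"
  then have "gcd (m k) n \<noteq> 1" using coprime_iff_gcd_eq_1 by blast
  then obtain p where "prime p" "p dvd gcd (m k) n" using prime_factor_nat by blast
  then have "prime p" "p dvd m k" "p dvd n" by simp_all
  then show False using prime_dvd_modulus[OF assms(1)] assms(2) not_le by blast
qed

text \<open>A common prime divides the difference \<open>j - i\<close> of \<open>Q + Suc j\<close>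
  and \<open>Q + Suc i\<close>, although it must exceed \<open>M\<close>.\<close>

lemma moduli_coprime:
  assumes "i < M" "j < M" "i \<noteq> j"
  shows "coprime (m i) (m j)"
proof -
  have *: "coprime (m i) (m j)" if "i < j" "j < M" for i j
  proof (rule ccontr)
    assume "\<not> coprime (m i) (m j)"
    then have "gcd (m i) (m j) \<noteq> 1" using coprime_iff_gcd_eq_1 by blast
    then obtain p where "prime p" "p dvd gcd (m i) (m j)" using prime_factor_nat by blast
    then have p: "prime p" "p dvd m i" "p dvd m j" by simp_all
    have "p dvd Q + Suc j" "p dvd Q + Suc i"
      using dvd_mult[OF p(2), of "Suc i"] dvd_mult[OF p(3), of "Suc j"] that
      by (simp_all only: modulus_mult less_trans[OF that])
    then have "p dvd (Q + Suc j) - (Q + Suc i)" by (rule dvd_diff_nat)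
    then have "p dvd j - i" by simp
    then have "p \<le> j - i" using that by (intro dvd_imp_le) auto
    then show False using prime_dvd_modulus[OF that(2) p(1,3)] that by linarith
  qed
  show ?thesis using *[of i j] *[of j i] assms by (metis coprime_commute linorder_neqE_nat)
qed

lemma prod_moduli: "y \<le> M \<Longrightarrow> (\<Prod>k<y. m k) = (Q + y) choose y"
proof (induction y)
  case (Suc y)
  have "Suc y * ((Q + Suc y) choose Suc y) = (Q + Suc y) * ((Q + y) choose y)"
    using Suc_times_binomial[of y "Q + y"] by simp
  also have "\<dots> = Suc y * (m y * ((Q + y) choose y))"
    using modulus_mult[of y] Suc.prems by (simp flip: mult.assoc)
  finally have "(Q + Suc y) choose Suc y = m y * ((Q + y) choose y)" by (simp only: mult_cancel1) simp
  then show ?case using Suc by simp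
qed simp

lemma modulus_gt_1: "k < M \<Longrightarrow> 1 < m k"
proof -
  assume "k < M"
  then have "Suc k * (Q div Suc k) = Q" using modulus_mult[of k] by (simp add: m_def)
  moreover have "0 < Q" by (simp add: Q_def)
  ultimately show ?thesis unfolding m_def by (metis less_add_same_cancel1 mult_0_right neq0_conv)
qed

end

text \<open>One \<open>c\<close> stands for all \<open>k < y\<close> and one \<open>A j\<close> for
  all values of the \<open>j\<close>-th unknown, each modulo \<open>m k\<close>. The range of these
  values is controlled by \<open>N dvd (A j choose u)\<close>: \<open>fact u\<close> times the
  binomial is the product of the \<open>A j - i\<close> for \<open>i < u\<close>, so a prime factor
  of \<open>m k\<close> divides one of them. Expressions are monotone, so \<open>B u\<close> bounds
  both sides; the primes exceed it, and the congruence becomes an equality.\<close>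

lemma bounded_all_iff:
  fixes p q :: pexp and v :: "nat \<Rightarrow> nat" and y :: nat
  defines "B u \<equiv> y + u + pval p (case_nat y v) (\<lambda>_. u) + pval q (case_nat y v) (\<lambda>_. u)"
  assumes K: "exvars p \<union> exvars q \<subseteq> {..<K}"
  shows "(\<forall>k<y. \<exists>w. pval p (case_nat k v) w = pval q (case_nat k v) w) \<longleftrightarrow>
    (\<exists>u Q N c. Q = (fact (B u))\<^sup>2 \<and> N = (Q + y) choose y \<and> N dvd c + Q + 1 \<and>
      (\<exists>A. (\<forall>j<K. N dvd (A j choose u)) \<and>
        [pval p (case_nat c v) A = pval q (case_nat c v) A] (mod N)))" (is "?L \<longleftrightarrow> ?R")
proof
  assume ?L
  then obtain w where w: "\<And>k. k < y \<Longrightarrow> pval p (case_nat k v) (w k) = pval q (case_nat k v) (w k)"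
    by metis
  define u where "u = Suc (\<Sum>k<y. \<Sum>j<K. w k j)"
  have wu: "w k j < u" if "k < y" "j < K" for k j
  proof -
    have "w k j \<le> (\<Sum>j<K. w k j)" using that by (intro member_le_sum) auto
    also have "\<dots> \<le> (\<Sum>k<y. \<Sum>j<K. w k j)"
      using that member_le_sum[of k "{..<y}" "\<lambda>k. \<Sum>j<K. w k j"] by auto
    finally show ?thesis by (simp add: u_def)
  qed
  define M where "M = B u"
  define Q where "Q = (fact M :: nat)\<^sup>2"
  define m where "m = (\<lambda>k. 1 + Q div Suc k)"
  interpret moduli M Q m by unfold_locales (simp_all add: Q_def m_def)
  have yM: "y \<le> M" and uM: "u \<le> M" by (simp_all add: M_def B_def)
  define N where "N = (Q + y) choose y"
  have N: "N = (\<Prod>k<y. m k)" using prod_moduli[OF yM] by (simp add: N_def)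
  have cop: "\<forall>i\<in>{..<y}. \<forall>j\<in>{..<y}. i \<noteq> j \<longrightarrow> coprime (m i) (m j)"
    using moduli_coprime yM by auto
  have mN: "m k dvd N" if "k < y" for k using that by (simp add: N dvd_prodI)
  have N0: "0 < N" unfolding N by (intro prod_pos) (simp add: m_def)
  \<comment> \<open>This is \<open>- (Q + 1)\<close> modulo \<open>N\<close> as a natural number; it
    is congruent to \<open>k\<close> modulo \<open>m k\<close> because \<open>m k\<close> divides
    \<open>Q + Suc k\<close>.\<close>
  define c where "c = (N - 1) * (Q + 1)"
  have "c + Q + 1 = N * (Q + 1)" using N0 by (cases N) (simp_all add: c_def)
  then have cN: "N dvd c + Q + 1" by simp
  have ck: "[c = k] (mod m k)" if "k < y" for k
  proof -
    have "m k dvd c + (Q + 1)" using dvd_trans[OF mN[OF that] cN] by simp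
    moreover have "m k dvd k + (Q + 1)"
      using dvd_triv_right[of "m k" "Suc k"] modulus_mult[of k] that yM
      by (simp del: mult_Suc add: add.commute)
    ultimately have "[c + (Q + 1) = k + (Q + 1)] (mod m k)" by (simp add: cong_def dvd_eq_mod_eq_0)
    then show ?thesis by (simp only: cong_add_rcancel_nat)
  qed
  have "\<exists>x. \<forall>k\<in>{..<y}. [x = w k j] (mod m k)" for j
    by (rule chinese_remainder_nat[OF _ cop]) simp
  then obtain A where A: "\<And>j k. k < y \<Longrightarrow> [A j = w k j] (mod m k)" by (metis lessThan_iff)
  have dvdA: "\<forall>j<K. N dvd (A j choose u)"
  proof (intro allI impI)
    fix j assume that: "j < K"
    have "[A j choose u = 0] (mod (\<Prod>k<y. m k))"
    proof (rule cong_cong_prod_coprime_nat[OF _ cop], rule ballI)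
      fix k assume "k \<in> {..<y}"
      then have k: "k < y" by simp
      have "m k dvd fact u * (A j choose u)"
      proof (cases "A j < u")
        case False
        then have "w k j \<le> A j" using wu[OF k that] by simp
        then have "m k dvd A j - w k j" using A[OF k, of j] by (simp add: cong_altdef_nat)
        also have "\<dots> dvd (\<Prod>i<u. A j - i)" using wu[OF k that] by (intro dvd_prodI) auto
        finally show ?thesis by (simp only: fact_times_binomial)
      qed (simp add: binomial_eq_0)
      moreover have "coprime (m k) (fact u)"
        using k yM uM by (intro modulus_coprime_small) (auto simp: prime_dvd_fact_iff)
      ultimately show "[A j choose u = 0] (mod m k)"
        by (simp add: coprime_dvd_mult_right_iff cong_0_iff)
    qed
    then show "N dvd (A j choose u)" by (simp only: cong_0_iff N)
  qed
  have eqA: "[pval p (case_nat c v) A = pval q (case_nat c v) A] (mod N)"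
    unfolding N
  proof (rule cong_cong_prod_coprime_nat[OF _ cop], rule ballI)
    fix k assume "k \<in> {..<y}"
    then have k: "k < y" by simp
    have "[pval e (case_nat c v) A = pval e (case_nat k v) (w k)] (mod m k)" for e
      by (rule pval_cong_mod) (auto simp: ck k A split: nat.split)
    from this[of p] this[of q] show "[pval p (case_nat c v) A = pval q (case_nat c v) A] (mod m k)"
      using w[OF k] by (metis cong_sym cong_trans)
  qed
  have "Q = (fact (B u))\<^sup>2" by (simp only: Q_def M_def)
  then show ?R
    by (intro exI[of _ u] exI[of _ Q] exI[of _ N] exI[of _ c] exI[of _ A] conjI N_def cN dvdA eqA)
next
  assume ?R
  then obtain u Q N c A where Q: "Q = (fact (B u))\<^sup>2" and N: "N = (Q + y) choose y"
    and c: "N dvd c + Q + 1" and A: "\<And>j. j < K \<Longrightarrow> N dvd (A j choose u)"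
    and eq: "[pval p (case_nat c v) A = pval q (case_nat c v) A] (mod N)" by blast
  define M where "M = B u"
  define m where "m = (\<lambda>k. 1 + Q div Suc k)"
  interpret moduli M Q m by unfold_locales (simp_all add: Q M_def m_def)
  have yM: "y \<le> M" and uM: "u \<le> M" by (simp_all add: M_def B_def)
  have N': "N = (\<Prod>k<y. m k)" using prod_moduli[OF yM] by (simp add: N)
  show ?L
  proof (intro allI impI)
    fix k assume k: "k < y"
    have kM: "k < M" using k yM by simp
    \<comment> \<open>A prime factor replaces \<open>m k\<close> here, since divisibility of a
      product must pass to one of its factors.\<close>
    obtain r where r: "prime r" "r dvd m k" using modulus_gt_1[OF kM] prime_factor_nat by (metis less_irrefl)
    have rM: "M < r" by (rule prime_dvd_modulus[OF kM r])
    have rN: "r dvd N" using r k by (auto simp: N' intro: dvd_trans dvd_prodI)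
    have ck: "[c = k] (mod r)"
    proof -
      have "r dvd c + (Q + 1)" using dvd_trans[OF rN c] by simp
      moreover have "r dvd k + (Q + 1)"
        using dvd_mult[OF r(2), of "Suc k"] modulus_mult[OF kM]
        by (simp del: mult_Suc add: add.commute)
      ultimately have "[c + (Q + 1) = k + (Q + 1)] (mod r)" by (simp add: cong_def dvd_eq_mod_eq_0)
      then show ?thesis by (simp only: cong_add_rcancel_nat)
    qed
    have "\<exists>x<u. [A j = x] (mod r)" if "j < K" for j
    proof (cases "A j < u")
      case False
      have "r dvd fact u * (A j choose u)" using dvd_trans[OF rN A[OF that]] by simp
      then obtain i where "i < u" "r dvd A j - i"
        unfolding fact_times_binomial using r(1) by (auto simp: prime_dvd_prod_iff)
      then show ?thesis using False by (intro exI[of _ i]) (simp add: cong_altdef_nat)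
    qed auto
    then obtain w where w: "\<And>j. j < K \<Longrightarrow> w j < u \<and> [A j = w j] (mod r)" by metis
    have e: "[pval e (case_nat c v) A = pval e (case_nat k v) w] (mod r) \<and>
        pval e (case_nat k v) w \<le> pval e (case_nat y v) (\<lambda>_. u)" if "exvars e \<subseteq> {..<K}" for e
    proof
      show "[pval e (case_nat c v) A = pval e (case_nat k v) w] (mod r)"
        using that by (intro pval_cong_mod) (auto simp: ck w split: nat.split)
      show "pval e (case_nat k v) w \<le> pval e (case_nat y v) (\<lambda>_. u)"
        using that k w by (intro pval_mono) (auto simp: less_imp_le split: nat.split)
    qed
    have "[pval p (case_nat k v) w = pval q (case_nat k v) w] (mod r)"
      using e[of p] e[of q] K cong_dvd_modulus_nat[OF eq rN] by (meson cong_sym cong_trans le_sup_iff)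
    moreover have "pval p (case_nat k v) w < r" "pval q (case_nat k v) w < r"
      using e[of p] e[of q] K rM by (auto simp: M_def B_def)
    ultimately have "pval p (case_nat k v) w = pval q (case_nat k v) w"
      by (simp add: cong_def)
    then show "\<exists>w. pval p (case_nat k v) w = pval q (case_nat k v) w" by blast
  qed
qed

lemma dfun_case_nat: "dfun f \<Longrightarrow> (\<And>i. dfun (\<lambda>v. g v i)) \<Longrightarrow> dfun (\<lambda>v. case_nat (f v) (g v) i)"
  by (cases i) auto

lemma dioph_ball [dio]:
  assumes f: "dfun f" and "dioph (\<lambda>v. Q (v 0) (\<lambda>i. v (Suc i)))"
  shows "dioph (\<lambda>v. \<forall>k<f v. Q k v)"
proof -
  obtain p q where "\<And>v. Q (v 0) (\<lambda>i. v (Suc i)) \<longleftrightarrow> (\<exists>w. pval p v w = pval q v w)"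
    using assms(2) unfolding dioph_def by blast
  from this[of "case_nat k v" for k v]
  have pq: "Q k v \<longleftrightarrow> (\<exists>w. pval p (case_nat k v) w = pval q (case_nat k v) w)" for k v by simp
  \<comment> \<open>The number \<open>K\<close> depends on the expressions alone, so the conditions
    for \<open>j < K\<close> form a finite conjunction.\<close>
  have "finite (exvars p \<union> exvars q)" by (simp add: finite_exvars)
  then obtain K where K: "exvars p \<union> exvars q \<subseteq> {..<K}"
    by (metis finite_nat_iff_bounded)
  show ?thesis
    unfolding pq bounded_all_iff[OF K] power2_eq_square
    by (intro dio dioph_exs dioph_Ball_fixed dfun_pval dfun_case_nat dfun_ren[OF f])
qed

section \<open>Recursive functions have Diophantine graphs\<close>

inductive_cases eval_ZeroE: "eval Zero xs y"
inductive_cases eval_SuccE: "eval Succ xs y"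
inductive_cases eval_ProjE: "eval (Proj i) xs y"
inductive_cases eval_CompE: "eval (Comp f gs) xs y"
inductive_cases eval_Prim0E: "eval (Prim f g) (0 # xs) y"
inductive_cases eval_PrimSucE: "eval (Prim f g) (Suc n # xs) y"
inductive_cases eval_PrimE: "eval (Prim f g) xs y"
inductive_cases eval_MnE: "eval (Mn f) xs y"

lemma eval_Zero_iff: "eval Zero xs y \<longleftrightarrow> y = 0"
  by (auto intro: eval.zero elim: eval_ZeroE)

lemma eval_Succ_iff: "eval Succ xs y \<longleftrightarrow> (\<exists>x zs. xs = x # zs \<and> y = Suc x)"
  by (auto intro: eval.succ elim: eval_SuccE)

lemma eval_Proj_iff: "eval (Proj i) xs y \<longleftrightarrow> i < length xs \<and> y = xs ! i"
  by (auto intro: eval.proj elim: eval_ProjE)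

lemma eval_Comp_iff:
  "eval (Comp f gs) xs y \<longleftrightarrow>
    (\<exists>w. (\<forall>i<length gs. eval (gs ! i) xs (w i)) \<and> eval f (map w [0..<length gs]) y)"
proof
  assume "eval (Comp f gs) xs y"
  then obtain ys where ys: "length ys = length gs" "\<forall>i<length gs. eval (gs ! i) xs (ys ! i)" "eval f ys y"
    by (rule eval_CompE)
  moreover have "map ((!) ys) [0..<length gs] = ys" using ys(1) by (metis map_nth)
  ultimately show "\<exists>w. (\<forall>i<length gs. eval (gs ! i) xs (w i)) \<and> eval f (map w [0..<length gs]) y"
    by (intro exI[of _ "(!) ys"]) simp
next
  assume "\<exists>w. (\<forall>i<length gs. eval (gs ! i) xs (w i)) \<and> eval f (map w [0..<length gs]) y"
  then show "eval (Comp f gs) xs y" by (auto intro!: eval.comp)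
qed

lemma eval_Mn_iff:
  "eval (Mn f) xs n \<longleftrightarrow> eval f (n # xs) 0 \<and> (\<forall>m<n. \<exists>y. 0 < y \<and> eval f (m # xs) y)"
  by (blast intro: eval.mn elim: eval_MnE)

lemma eval_Prim_seq_iff:
  "eval (Prim f g) (n # xs) y \<longleftrightarrow>
    (\<exists>z. eval f xs (z 0) \<and> (\<forall>i<n. eval g (z i # i # xs) (z (Suc i))) \<and> y = z n)"
proof (induction n arbitrary: y)
  case 0
  show ?case by (auto intro: eval.prim0 elim: eval_Prim0E)
next
  case (Suc n)
  show ?case
  proof
    assume "eval (Prim f g) (Suc n # xs) y"
    then obtain x where x: "eval (Prim f g) (n # xs) x" "eval g (x # n # xs) y"
      by (rule eval_PrimSucE)
    then obtain z where z: "eval f xs (z 0)" "\<forall>i<n. eval g (z i # i # xs) (z (Suc i))" "x = z n"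
      using Suc by blast
    then show "\<exists>z. eval f xs (z 0) \<and> (\<forall>i<Suc n. eval g (z i # i # xs) (z (Suc i))) \<and> y = z (Suc n)"
      using x by (intro exI[of _ "z(Suc n := y)"]) (auto simp: less_Suc_eq)
  next
    assume "\<exists>z. eval f xs (z 0) \<and> (\<forall>i<Suc n. eval g (z i # i # xs) (z (Suc i))) \<and> y = z (Suc n)"
    then obtain z where z: "eval f xs (z 0)" "\<forall>i<Suc n. eval g (z i # i # xs) (z (Suc i))" "y = z (Suc n)"
      by blast
    then have "eval (Prim f g) (n # xs) (z n)" using Suc by auto
    then show "eval (Prim f g) (Suc n # xs) y" using z by (auto intro: eval.primS)
  qed
qed

text \<open>The intermediate values are the base-\<open>b\<close> digits of \<open>c\<close>, so two
  numbers replace the sequence and the steps form a bounded universal quantifier.\<close>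

lemma eval_Prim_iff:
  "eval (Prim f g) (n # xs) y \<longleftrightarrow>
    (\<exists>b c. eval f xs (c mod b) \<and> y = c div b ^ n mod b \<and>
      (\<forall>i<n. eval g ((c div b ^ i mod b) # i # xs) (c div b ^ Suc i mod b)))"
proof
  assume "eval (Prim f g) (n # xs) y"
  then obtain z where z: "eval f xs (z 0)" "\<forall>i<n. eval g (z i # i # xs) (z (Suc i))" "y = z n"
    unfolding eval_Prim_seq_iff by blast
  define b where "b = Suc (\<Sum>i\<le>n. z i)"
  \<comment> \<open>\<open>digit_extract\<close> wants every digit below the base, also beyond the
    summation range, hence the zeros after \<open>n\<close>.\<close>
  define c where "c = (\<Sum>i<Suc n. (if i \<le> n then z i else 0) * b ^ i)"
  have "z i < b" if "i \<le> n" for i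
    using that member_le_sum[of i "{..n}" z] by (simp add: b_def less_Suc_eq_le)
  then have c: "c div b ^ i mod b = z i" if "i \<le> n" for i
    using that unfolding c_def by (subst digit_extract) (auto simp: b_def)
  show "\<exists>b c. eval f xs (c mod b) \<and> y = c div b ^ n mod b \<and>
      (\<forall>i<n. eval g ((c div b ^ i mod b) # i # xs) (c div b ^ Suc i mod b))"
    by (rule exI[of _ b], rule exI[of _ c]) (use z c c[of 0] in \<open>auto simp del: power_Suc\<close>)
next
  assume "\<exists>b c. eval f xs (c mod b) \<and> y = c div b ^ n mod b \<and>
      (\<forall>i<n. eval g ((c div b ^ i mod b) # i # xs) (c div b ^ Suc i mod b))"
  then obtain b c where *: "eval f xs (c mod b)" "y = c div b ^ n mod b"
      "\<forall>i<n. eval g ((c div b ^ i mod b) # i # xs) (c div b ^ Suc i mod b)" by blast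
  then show "eval (Prim f g) (n # xs) y"
    unfolding eval_Prim_seq_iff by (intro exI[of _ "\<lambda>i. c div b ^ i mod b"]) simp
qed

lemma eval_Prim_Nil: "\<not> eval (Prim f g) [] y"
  by (auto elim: eval_PrimE)

lemma dioph_False: "dioph (\<lambda>v. False)"
proof -
  have "dioph (\<lambda>v. (0 :: nat) = 1)" by (intro dio)
  then show ?thesis by simp
qed

text \<open>Arguments and result are arbitrary Diophantine functions rather than parameters, so that
  the induction hypotheses apply to the shifted and computed arguments of each case.\<close>

theorem dioph_eval:
  assumes "\<forall>g\<in>set gs. dfun g" and "dfun h"
  shows "dioph (\<lambda>v. eval f (map (\<lambda>g. g v) gs) (h v))"
  using assms
proof (induction f arbitrary: gs h)
  case Zero
  then show ?case unfolding eval_Zero_iff by (intro dio)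
next
  case Succ
  show ?case
  proof (cases gs)
    case Nil
    then show ?thesis by (simp add: eval_Succ_iff dioph_False)
  next
    case (Cons g gs')
    then have "dioph (\<lambda>v. h v = Suc (g v))" using Succ by (intro dio) auto
    then show ?thesis by (simp add: eval_Succ_iff Cons)
  qed
next
  case (Proj i)
  show ?case
  proof (cases "i < length gs")
    case True
    then have "dioph (\<lambda>v. h v = (gs ! i) v)" using Proj by (intro dio) auto
    then show ?thesis using True by (simp add: eval_Proj_iff)
  next
    case False
    then show ?thesis by (simp add: eval_Proj_iff dioph_False)
  qed
next
  case (Comp f fs)
  note ren = dfun_ren[of _ "\<lambda>i. Suc (2 * i)"]
  have "dioph (\<lambda>v. eval (fs ! i) (map (\<lambda>g. g (\<lambda>i. v (Suc (2 * i)))) gs) (v (2 * i)))"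
    if "i < length fs" for i
    using Comp.IH(2)[of "fs ! i" "map (\<lambda>g v. g (\<lambda>i. v (Suc (2 * i)))) gs" "\<lambda>v. v (2 * i)"]
      that Comp.prems by (auto simp: comp_def dfun_par ren)
  moreover have "dioph (\<lambda>v. eval f (map (\<lambda>i. v (2 * i)) [0..<length fs]) (h (\<lambda>i. v (Suc (2 * i)))))"
    using Comp.IH(1)[of "map (\<lambda>i v. v (2 * i)) [0..<length fs]" "\<lambda>v. h (\<lambda>i. v (Suc (2 * i)))"]
      Comp.prems by (auto simp: comp_def dfun_par ren)
  ultimately show ?case
    unfolding eval_Comp_iff by (intro dioph_exs dioph_conj dioph_Ball_fixed)
next
  case (Prim f g)
  show ?case
  proof (cases gs)
    case Nil
    then show ?thesis by (simp add: eval_Prim_Nil dioph_False)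
  next
    case (Cons n gs')
    have ren: "dfun (\<lambda>v. k (\<lambda>i. v (r i)))" if "k \<in> set gs' \<or> k = n \<or> k = h" for k r
      using that Prim.prems Cons by (auto intro: dfun_ren)
    let ?r2 = "\<lambda>v i. v (Suc (Suc i))" and ?r3 = "\<lambda>v i. v (Suc (Suc (Suc i)))"
    have ren2: "dfun (\<lambda>v. k (?r2 v))" and ren3: "dfun (\<lambda>v. k (?r3 v))" if "k \<in> set gs'" for k
      using that by - (rule ren, simp)+
    have nr: "dfun (\<lambda>v. n (\<lambda>i. v (r i)))" and hr: "dfun (\<lambda>v. h (\<lambda>i. v (r i)))" for r
      by (rule ren, simp)+
    have evf: "dioph (\<lambda>v. eval f (map (\<lambda>k. k (?r2 v)) gs') (v 0 mod v (Suc 0)))"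
      using Prim.IH(1)[of "map (\<lambda>k v. k (?r2 v)) gs'" "\<lambda>v. v 0 mod v (Suc 0)"]
      by (simp add: comp_def ren2 dfun_par dfun_mod)
    have evg: "dioph (\<lambda>v. eval g
        ((v (Suc 0) div v (Suc (Suc 0)) ^ v 0 mod v (Suc (Suc 0))) # v 0 # map (\<lambda>k. k (?r3 v)) gs')
        (v (Suc 0) div v (Suc (Suc 0)) ^ Suc (v 0) mod v (Suc (Suc 0))))"
      using Prim.IH(2)[of "(\<lambda>v. v (Suc 0) div v (Suc (Suc 0)) ^ v 0 mod v (Suc (Suc 0))) #
          (\<lambda>v. v 0) # map (\<lambda>k v. k (?r3 v)) gs'"
          "\<lambda>v. v (Suc 0) div v (Suc (Suc 0)) ^ Suc (v 0) mod v (Suc (Suc 0))"]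
      by (simp add: comp_def ren3 dfun_par dfun_mod dfun_div dfun_power dfun_Suc del: power_Suc)
    show ?thesis
      unfolding Cons list.map eval_Prim_iff by (intro dio nr hr evf evg)
  qed
next
  case (Mn f)
  have "dioph (\<lambda>v. eval f (map (\<lambda>g. g v) (h # gs)) 0)"
    using Mn.prems by (intro Mn.IH dio) auto
  moreover have "dioph (\<lambda>v. eval f (v (Suc 0) # map (\<lambda>g. g (\<lambda>i. v (Suc (Suc i)))) gs) (v 0))"
    using Mn.IH[of "(\<lambda>v. v (Suc 0)) # map (\<lambda>g v. g (\<lambda>i. v (Suc (Suc i)))) gs" "\<lambda>v. v 0"] Mn.prems
    by (auto simp: comp_def dfun_par dfun_ren[of _ "\<lambda>i. Suc (Suc i)"])
  ultimately show ?case
    unfolding eval_Mn_iff using Mn.prems by (intro dio) simp_all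
qed

lemma eval_deterministic: "eval f xs y \<Longrightarrow> eval f xs y' \<Longrightarrow> y = y'"
proof (induction arbitrary: y' rule: eval.induct)
  case (comp ys gs xs f y)
  from comp.prems obtain zs where zs: "length zs = length gs"
    "\<forall>i<length gs. eval (gs ! i) xs (zs ! i)" "eval f zs y'" by (rule eval_CompE)
  then have "ys = zs" using comp by (intro nth_equalityI) auto
  then show ?case using comp zs by blast
next
  case (primS f g n xs z y)
  from primS.prems obtain x where "eval (Prim f g) (n # xs) x" "eval g (x # n # xs) y'"
    by (rule eval_PrimSucE)
  then show ?case using primS by blast
next
  case (mn f n xs)
  from mn.prems have *: "eval f (y' # xs) 0" "\<forall>m<y'. \<exists>y. 0 < y \<and> eval f (m # xs) y"
    by (auto simp: eval_Mn_iff)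
  show ?case
  proof (rule linorder_cases[of n y'])
    assume "n < y'"
    then obtain y where "0 < y" "eval f (n # xs) y" using * by blast
    then show ?thesis using mn.IH(1)[of y] by simp
  next
    assume "y' < n"
    then obtain y where "0 < y" "\<forall>x. eval f (y' # xs) x \<longrightarrow> y = x" using mn.IH(2) by blast
    then have "y = 0" using *(1) by simp
    then show ?thesis using \<open>0 < y\<close> by simp
  qed
next
  case (prim0 f xs y g)
  from prim0.prems have "eval f xs y'" by (rule eval_Prim0E)
  then show ?case using prim0.IH by simp
qed (auto simp: eval_Zero_iff eval_Succ_iff eval_Proj_iff)

section \<open>The four squares theorem\<close>

definition four_squares :: "int \<Rightarrow> bool" where
  "four_squares n \<longleftrightarrow> (\<exists>a b c d. n = a * a + b * b + c * c + d * d)"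

lemma euler_four_squares:
  "(a * a + b * b + c * c + d * d) * (A * A + B * B + C * C + D * D) =
    (a * A + b * B + c * C + d * D) * (a * A + b * B + c * C + d * D) +
    (a * B - b * A + (c * D - d * C)) * (a * B - b * A + (c * D - d * C)) +
    (a * C - c * A + (d * B - b * D)) * (a * C - c * A + (d * B - b * D)) +
    (a * D - d * A + (b * C - c * B)) * (a * D - d * A + (b * C - c * (B :: int)))"
  by (simp add: algebra_simps)

lemma four_squares_mult: "four_squares m \<Longrightarrow> four_squares n \<Longrightarrow> four_squares (m * n)"
  unfolding four_squares_def by (elim exE) (simp only: euler_four_squares, blast)

text \<open>Pigeonhole: the \<open>h + 1\<close> residues of squares and the \<open>h + 1\<close>
  residues of \<open>- 1 - b * b\<close> cannot be disjoint among \<open>2 * h + 1\<close>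
  residues.\<close>

lemma ex_cong_square_plus_one:
  assumes p: "prime p" "p = 2 * h + (1 :: nat)"
  shows "\<exists>a b. a \<le> h \<and> b \<le> h \<and> p dvd a * a + b * b + 1"
proof -
  have inj: "inj_on (\<lambda>a. a * a mod p) {..h}"
  proof (rule linorder_inj_onI')
    fix i j assume ij: "i \<in> {..h}" "j \<in> {..h}" "i < j"
    show "i * i mod p \<noteq> j * j mod p"
    proof
      assume "i * i mod p = j * j mod p"
      then have "[j * j = i * i] (mod p)" by (simp add: cong_def)
      moreover have "i * i \<le> j * j" using ij by (intro mult_mono) auto
      ultimately have "p dvd j * j - i * i" by (simp add: cong_altdef_nat)
      also have "j * j - i * i = (j - i) * (j + i)"
        using ij by (simp add: diff_mult_distrib algebra_simps)
      finally have "p dvd j - i \<or> p dvd j + i" using p(1) by (simp add: prime_dvd_mult_iff)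
      then show False using ij p(2) dvd_imp_le[of p "j - i"] dvd_imp_le[of p "j + i"] by auto
    qed
  qed
  let ?S = "(\<lambda>a. a * a mod p) ` {..h}"
  let ?T = "(\<lambda>x. p - 1 - x) ` ?S"
  have S: "?S \<subseteq> {..<p}" using p(2) by auto
  have "inj_on (\<lambda>x. p - 1 - x) ?S"
  proof (rule inj_onI)
    fix x y assume "x \<in> ?S" "y \<in> ?S" "p - 1 - x = p - 1 - y"
    moreover from this have "x < p" "y < p" using S by auto
    ultimately show "x = y" by linarith
  qed
  then have cT: "card ?T = h + 1" using inj by (simp add: card_image)
  have cS: "card ?S = h + 1" using inj by (simp add: card_image)
  have T: "?T \<subseteq> {..<p}" using p(2) by auto
  have "?S \<inter> ?T \<noteq> {}"
  proof
    assume "?S \<inter> ?T = {}"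
    then have "card (?S \<union> ?T) = 2 * h + 2" using cS cT by (subst card_Un_disjoint) auto
    moreover have "card (?S \<union> ?T) \<le> card {..<p}" using S T by (intro card_mono) auto
    ultimately show False using p(2) by simp
  qed
  then obtain a b where ab: "a \<le> h" "b \<le> h" "a * a mod p = p - 1 - b * b mod p" by auto
  have "b * b mod p < p" using p(2) by simp
  then have "a * a mod p + b * b mod p + 1 = p" using ab(3) by linarith
  then have "(a * a mod p + b * b mod p + 1) mod p = 0" by simp
  then have "(a * a + b * b + 1) mod p = 0" by (metis mod_add_left_eq mod_add_eq)
  then show ?thesis using ab by (auto simp: mod_eq_0_iff_dvd)
qed

lemma ex_small_residue:
  assumes "0 < (m :: int)"
  shows "\<exists>y. m dvd x - y \<and> 2 * \<bar>y\<bar> \<le> m"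
proof (cases "2 * (x mod m) \<le> m")
  case True
  then show ?thesis using assms by (intro exI[of _ "x mod m"]) (auto simp: dvd_minus_mod)
next
  case False
  have "m dvd (x - x mod m) + m" by (intro dvd_add dvd_minus_mod) auto
  moreover have "x mod m < m" using assms by simp
  ultimately have "m dvd x - (x mod m - m) \<and> 2 * \<bar>x mod m - m\<bar> \<le> m"
    using False by (auto simp: algebra_simps abs_if)
  then show ?thesis by blast
qed

text \<open>With \<open>x = y + m * k\<close> the cross term is \<open>2 * y * m * k\<close>, and
  \<open>2 * y\<close> equals \<open>m\<close> up to sign. The descent needs this when all residues
  have the extreme size.\<close>

lemma square_cong_half:
  assumes "m dvd x - y" "2 * \<bar>y\<bar> = (m :: int)"
  shows "m * m dvd x * x - y * y"
proof -
  obtain k where k: "x = y + m * k" using assms(1) by (metis dvdE add.commute diff_add_cancel)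
  have "m * m dvd m * (2 * y) * (k + k * k) \<and> 2 * y = m \<or> m * m dvd m * (2 * y) * (k - k * k) \<and> 2 * y = - m"
    using assms(2) by (cases "y \<ge> 0") auto
  moreover have "x * x - y * y = m * (2 * y) * k + m * m * (k * k)" by (simp add: k algebra_simps)
  ultimately show ?thesis by auto
qed

text \<open>Lagrange's descent: the absolutely least residues modulo \<open>m\<close> have square
  sum \<open>m * r\<close> with \<open>r \<le> m\<close>. In Euler's identity for
  \<open>m * p\<close> times \<open>m * r\<close> all four terms are divisible by \<open>m\<close>,
  and cancelling \<open>m * m\<close> leaves \<open>r * p\<close>.\<close>

lemma four_squares_descent:
  assumes p: "prime p" and m: "1 < m" "m < p" and s: "four_squares (m * p)"
  shows "\<exists>r. 0 < r \<and> r < m \<and> four_squares (r * p)"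
proof -
  obtain a b c d where eq: "m * p = a * a + b * b + c * c + d * d"
    using s unfolding four_squares_def by blast
  have m0: "0 < m" using m by simp
  obtain A where A: "m dvd a - A" "2 * \<bar>A\<bar> \<le> m" using ex_small_residue[OF m0] by blast
  obtain B where B: "m dvd b - B" "2 * \<bar>B\<bar> \<le> m" using ex_small_residue[OF m0] by blast
  obtain C where C: "m dvd c - C" "2 * \<bar>C\<bar> \<le> m" using ex_small_residue[OF m0] by blast
  obtain D where D: "m dvd d - D" "2 * \<bar>D\<bar> \<le> m" using ex_small_residue[OF m0] by blast
  \<comment> \<open>Either extreme, \<open>r = 0\<close> or \<open>r = m\<close>, would contradict
    this.\<close>
  have nd: "\<not> m * m dvd m * p"
  proof
    assume "m * m dvd m * p"
    then have "m dvd p" using m0 by simp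
    then show False using p m by (auto simp: prime_int_iff dest!: spec[of _ m])
  qed
  have sq: "m dvd x * x - X * X" if "m dvd x - X" for x X
  proof -
    have "x * x - X * X = (x - X) * (x + X)" by (simp add: algebra_simps)
    then show ?thesis using that by simp
  qed
  have "m dvd m * p - ((a * a - A * A) + (b * b - B * B) + (c * c - C * C) + (d * d - D * D))"
    by (rule dvd_diff[OF dvd_triv_left]) (intro dvd_add sq A(1) B(1) C(1) D(1))
  also have "m * p - ((a * a - A * A) + (b * b - B * B) + (c * c - C * C) + (d * d - D * D)) =
      A * A + B * B + C * C + D * D"
    unfolding eq by (simp add: algebra_simps)
  finally obtain r where r: "A * A + B * B + C * C + D * D = m * r" by (elim dvdE)
  have bd: "4 * (X * X) \<le> m * m" if "2 * \<bar>X\<bar> \<le> m" for X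
    using mult_mono[OF that that] m0 by (simp add: abs_mult[symmetric])
  have eqd: "2 * \<bar>X\<bar> = m" if "4 * (X * X) = m * m" for X
  proof -
    have "(2 * \<bar>X\<bar>)\<^sup>2 = m\<^sup>2" using that by (simp add: power2_eq_square abs_mult[symmetric])
    then show ?thesis by (rule power2_eq_imp_eq) (use m0 in simp_all)
  qed
  note bds = bd[OF A(2)] bd[OF B(2)] bd[OF C(2)] bd[OF D(2)]
  have "m * r \<le> m * m" using bds r by linarith
  then have rm: "r \<le> m" using m0 by simp
  have "0 \<le> m * r" unfolding r[symmetric] by simp
  then have r0: "0 \<le> r" using m0 by (simp add: zero_le_mult_iff)
  have "r \<noteq> 0"
  proof
    assume "r = 0"
    then have "A * A + B * B + C * C + D * D = 0" using r by simp
    moreover have "0 \<le> A * A" "0 \<le> B * B" "0 \<le> C * C" "0 \<le> D * D" by simp_all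
    ultimately have "A * A = 0" "B * B = 0" "C * C = 0" "D * D = 0" by linarith+
    then have "m dvd a" "m dvd b" "m dvd c" "m dvd d" using A B C D by auto
    then have "m * m dvd m * p" unfolding eq by (intro dvd_add mult_dvd_mono)
    then show False using nd by simp
  qed
  moreover have "r \<noteq> m"
  proof
    assume "r = m"
    then have "A * A + B * B + C * C + D * D = m * m" using r by simp
    then have "4 * (A * A) = m * m" "4 * (B * B) = m * m" "4 * (C * C) = m * m" "4 * (D * D) = m * m"
      using bds by linarith+
    then have "m * m dvd (a * a - A * A) + (b * b - B * B) + (c * c - C * C) + (d * d - D * D)"
      using A B C D eqd by (intro dvd_add square_cong_half) auto
    then have "m * m dvd (a * a - A * A) + (b * b - B * B) + (c * c - C * C) + (d * d - D * D) + m * m"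
      by (rule dvd_add[OF _ dvd_refl])
    also have "(a * a - A * A) + (b * b - B * B) + (c * c - C * C) + (d * d - D * D) + m * m = m * p"
      using r \<open>r = m\<close> unfolding eq by simp
    finally show False using nd by simp
  qed
  moreover have "four_squares (r * p)"
  proof -
    have cross: "m dvd x * Y - y * X" if "m dvd x - X" "m dvd y - Y" for x y X Y
    proof -
      have "x * Y - y * X = (x - X) * y - (y - Y) * x" by (simp add: algebra_simps)
      then show ?thesis using that by simp
    qed
    have "m dvd m * p - (a * (a - A) + b * (b - B) + c * (c - C) + d * (d - D))"
      using A B C D by (intro dvd_diff dvd_add) auto
    also have "m * p - (a * (a - A) + b * (b - B) + c * (c - C) + d * (d - D)) =
        a * A + b * B + c * C + d * D"
      unfolding eq by (simp add: algebra_simps)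
    finally obtain s where s: "a * A + b * B + c * C + d * D = m * s" by (elim dvdE)
    have "m dvd a * B - b * A + (c * D - d * C)" using A B C D by (intro dvd_add cross)
    then obtain t where t: "a * B - b * A + (c * D - d * C) = m * t" by (elim dvdE)
    have "m dvd a * C - c * A + (d * B - b * D)" using A B C D by (intro dvd_add cross)
    then obtain u where u: "a * C - c * A + (d * B - b * D) = m * u" by (elim dvdE)
    have "m dvd a * D - d * A + (b * C - c * B)" using A B C D by (intro dvd_add cross)
    then obtain v where v: "a * D - d * A + (b * C - c * B) = m * v" by (elim dvdE)
    have "m * p * (m * r) = m * s * (m * s) + m * t * (m * t) + m * u * (m * u) + m * v * (m * v)"
      unfolding eq r[symmetric] euler_four_squares s t u v ..
    then have "m * m * (r * p) = m * m * (s * s + t * t + u * u + v * v)"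
      by (simp add: algebra_simps)
    then have "r * p = s * s + t * t + u * u + v * v" using m0 by simp
    then show ?thesis unfolding four_squares_def by blast
  qed
  ultimately show ?thesis using rm r0 by (intro exI[of _ r]) linarith
qed

lemma four_squares_prime:
  assumes "prime (p :: nat)"
  shows "four_squares (int p)"
proof (cases "p = 2")
  case True
  then show ?thesis unfolding four_squares_def by (intro exI[of _ 1] exI[of _ 1] exI[of _ 0] exI[of _ 0]) simp
next
  case False
  then have "odd p" using assms by (metis prime_odd_nat prime_gt_1_nat Suc_leI le_neq_implies_less numeral_2_eq_2 One_nat_def)
  then obtain h where h: "p = 2 * h + 1" by (elim oddE)
  obtain a b where ab: "a \<le> h" "b \<le> h" "p dvd a * a + b * b + 1"
    using ex_cong_square_plus_one[OF assms h] by blast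
  then obtain m where m: "a * a + b * b + 1 = p * m" by (elim dvdE)
  have "a * a + b * b + 1 \<le> h * h + h * h + 1" using ab by (intro add_mono mult_mono) auto
  also have "\<dots> < p * p" using prime_gt_1_nat[OF assms] by (simp add: h algebra_simps)
  finally have "m < p" using m by simp
  have "four_squares (int m * int p)"
  proof -
    have "int m * int p = int a * int a + int b * int b + 1 * 1 + 0 * 0"
      using arg_cong[OF m, of int] by (simp add: mult.commute)
    then show ?thesis unfolding four_squares_def by blast
  qed
  moreover have "0 < m" using m by (cases m) auto
  ultimately show ?thesis using \<open>m < p\<close>
  proof (induction m rule: less_induct)
    case (less m)
    show ?case
    proof (cases "m = 1")
      case False
      then have "\<exists>r. 0 < r \<and> r < int m \<and> four_squares (r * int p)"
        using less.prems assms by (intro four_squares_descent) auto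
      then obtain r where r: "0 < r" "r < int m" "four_squares (r * int p)" by blast
      then show ?thesis using less.IH[of "nat r"] less.prems by auto
    qed (use less in simp)
  qed
qed

lemma four_squares_nat: "four_squares (int n)"
proof (induction n rule: less_induct)
  case (less n)
  show ?case
  proof (cases "n \<le> 1")
    case True
    then have "int n = int n * int n + 0 * 0 + 0 * 0 + 0 * 0" by (cases n) auto
    then show ?thesis unfolding four_squares_def by blast
  next
    case False
    then have "n \<noteq> 1" by simp
    then obtain p where p: "prime p" "p dvd n" using prime_factor_nat by blast
    then obtain k where k: "n = p * k" by (elim dvdE)
    then have "0 < k" using False by (cases k) auto
    then have "1 * k < p * k" using prime_gt_1_nat[OF p(1)] by (intro mult_strict_right_mono) auto
    then have "k < n" by (simp add: k)
    then have "four_squares (int p * int k)"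
      by (intro four_squares_mult four_squares_prime p less)
    then show ?thesis by (simp add: k)
  qed
qed

section \<open>The group\<close>

lemma G_eq_append: "G_eq u u' \<Longrightarrow> G_eq v v' \<Longrightarrow> G_eq (u @ v) (u' @ v')"
  using G_eq.ctxt[of u u' "[]" v] G_eq.ctxt[of v v' u' "[]"] by (auto intro: G_eq.trans)

lemma inv_word_Nil: "inv_word [] = []"
  by (simp add: inv_word_def)

lemma inv_word_inv_word: "inv_word (inv_word w) = w"
  by (simp add: inv_word_def rev_map comp_def case_prod_beta)

lemma G_eq_inv_right: "G_eq (w @ inv_word w) []"
proof (induction w)
  case Nil
  then show ?case by (simp add: inv_word_Nil G_eq.refl)
next
  case (Cons l w)
  obtain i e where l: "l = (i, e)" by (cases l)
  have "G_eq ([l] @ (w @ inv_word w) @ [(i, \<not> e)]) ([l] @ [] @ [(i, \<not> e)])"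
    by (rule G_eq.ctxt[OF Cons])
  moreover have "G_eq ([l] @ [] @ [(i, \<not> e)]) []" by (simp add: l G_eq.cancel)
  moreover have "(l # w) @ inv_word (l # w) = [l] @ (w @ inv_word w) @ [(i, \<not> e)]"
    by (simp add: inv_word_def l)
  ultimately show ?case using G_eq.trans by simp
qed

lemma G_eq_inv_left: "G_eq (inv_word w @ w) []"
  using G_eq_inv_right[of "inv_word w"] by (simp add: inv_word_inv_word)

lemma G_eq_inv:
  assumes "G_eq u v"
  shows "G_eq (inv_word u) (inv_word v)"
proof -
  have "G_eq (inv_word u @ v @ inv_word v) (inv_word u @ u @ inv_word v)"
    by (rule G_eq.ctxt[OF G_eq.sym[OF assms]])
  moreover have "G_eq (inv_word u @ v @ inv_word v) (inv_word u)"
    using G_eq.ctxt[OF G_eq_inv_right[of v], of "inv_word u" "[]"] by simp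
  moreover have "G_eq (inv_word u @ u @ inv_word v) (inv_word v)"
    using G_eq.ctxt[OF G_eq_inv_left[of u], of "[]" "inv_word v"] by simp
  ultimately show ?thesis by (meson G_eq.sym G_eq.trans)
qed

text \<open>The group of words modulo \<^const>\<open>G_eq\<close> is written additively although it is not
  commutative.  Letters with index at least 5 survive as free generators.\<close>
quotient_type grp = word / G_eq
  by (rule equivpI) (auto simp: reflp_def symp_def transp_def intro: G_eq.refl G_eq.sym G_eq.trans)

instantiation grp :: group_add
begin
lift_definition zero_grp :: grp is "[]" .
lift_definition plus_grp :: "grp \<Rightarrow> grp \<Rightarrow> grp" is "(@)" by (rule G_eq_append)
lift_definition uminus_grp :: "grp \<Rightarrow> grp" is inv_word by (rule G_eq_inv)
definition minus_grp :: "grp \<Rightarrow> grp \<Rightarrow> grp" where "minus_grp a b = a + - b"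
instance
proof
  fix a b c :: grp
  show "a + b + c = a + (b + c)" by transfer (simp add: G_eq.refl)
  show "0 + a = a" by transfer (simp add: G_eq.refl)
  show "a + 0 = a" by transfer (simp add: G_eq.refl)
  show "- a + a = 0" by transfer (rule G_eq_inv_left)
  show "a + - b = a - b" by (simp add: minus_grp_def)
qed
end

lift_definition gen :: "nat \<Rightarrow> grp" is "\<lambda>i. [(i, True)]" .

lemma gen_inverse: "- gen i = abs_grp [(i, False)]"
  by (simp add: gen.abs_eq uminus_grp.abs_eq inv_word_def)

lemma abs_letter: "abs_grp [(i, e)] = (if e then gen i else - gen i)"
  by (cases e) (simp_all add: gen_inverse, simp add: gen.abs_eq)

definition wval :: "(nat \<Rightarrow> grp) \<Rightarrow> word \<Rightarrow> grp" where
  "wval f w = sum_list (map (\<lambda>(i, e). if e then f i else - f i) w)"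

lemma wval_Nil: "wval f [] = 0" by (simp add: wval_def)
lemma wval_Cons: "wval f ((i, e) # w) = (if e then f i else - f i) + wval f w"
  by (simp add: wval_def)
lemma wval_append: "wval f (u @ v) = wval f u + wval f v" by (simp add: wval_def)

lemma wval_inv_word: "wval f (inv_word w) = - wval f w"
proof (induction w)
  case (Cons l w)
  obtain i e where l: "l = (i, e)" by (cases l)
  have "inv_word (l # w) = inv_word w @ [(i, \<not> e)]" by (simp add: inv_word_def l)
  then show ?case by (simp add: Cons wval_append wval_Cons wval_Nil l minus_add)
qed (simp add: inv_word_Nil wval_Nil)

lemma abs_grp_eq_wval: "abs_grp w = wval gen w"
proof (induction w)
  case (Cons l w)
  obtain i e where l: "l = (i, e)" by (cases l)
  have "abs_grp (l # w) = abs_grp [l] + abs_grp w" by (simp add: plus_grp.abs_eq)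
  then show ?case by (simp add: Cons abs_letter wval_Cons l)
qed (simp add: wval_Nil zero_grp.abs_eq)

lemma abs_subst:
  "abs_grp (subst \<sigma> w) = wval (\<lambda>i. if i < 5 then gen i else abs_grp (\<sigma> i)) w"
proof (induction w)
  case (Cons l w)
  obtain i e where l: "l = (i, e)" by (cases l)
  have "abs_grp (subst \<sigma> (l # w)) = abs_grp (subst \<sigma> [l]) + abs_grp (subst \<sigma> w)"
    by (simp add: plus_grp.abs_eq subst_def)
  moreover have "abs_grp (subst \<sigma> [l]) =
      (let g = if i < 5 then gen i else abs_grp (\<sigma> i) in if e then g else - g)"
    by (simp add: l subst_def abs_letter uminus_grp.abs_eq)
  ultimately show ?case by (simp only: Cons wval_Cons l Let_def)
qed (simp add: wval_Nil zero_grp.abs_eq subst_def)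

lemma G_eq_Nil_iff: "G_eq w [] \<longleftrightarrow> abs_grp w = 0"
  by (simp add: zero_grp.abs_eq grp.abs_eq_iff)

text \<open>From here on variables take group elements as values; \<open>G_word\<close> keeps the
  extra free generators out of them.\<close>

lemma solvable_iff:
  "solvable sys \<longleftrightarrow> (\<exists>\<sigma>. (\<forall>i. G_word (\<sigma> i)) \<and>
    (\<forall>w\<in>set sys. wval (\<lambda>i. if i < 5 then gen i else abs_grp (\<sigma> i)) w = 0))"
  by (simp add: solvable_def G_eq_Nil_iff abs_subst)

abbreviation ga :: grp where "ga \<equiv> gen 0"
abbreviation gb :: grp where "gb \<equiv> gen (Suc 0)"
abbreviation gc :: grp where "gc \<equiv> gen 2"
abbreviation gs :: grp where "gs \<equiv> gen 3"
abbreviation gt :: grp where "gt \<equiv> gen 4"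

lemma relator_eq_0: "r \<in> relators \<Longrightarrow> wval gen r = 0"
  by (simp flip: abs_grp_eq_wval G_eq_Nil_iff add: G_eq.rel)

context
  notes add_uminus_conv_diff [simp del]
begin

lemma grp_relation:
  assumes "[(i, True), (j, True), (i, False)] @ inv_word u \<in> relators"
  shows "gen i + gen j = wval gen u + gen i"
proof -
  have "(gen i + gen j + - gen i) - wval gen u = 0"
    using relator_eq_0[OF assms]
    by (simp add: wval_append wval_inv_word wval_Cons wval_Nil add.assoc diff_conv_add_uminus)
  then have "gen i + gen j + - gen i = wval gen u" by (simp only: right_minus_eq)
  then have "gen i + gen j + - gen i + gen i = wval gen u + gen i" by simp
  then show ?thesis by (simp add: add.assoc)
qed

lemma grp_relations:
  "gs + ga = ga + gb + gs" "gs + gb = gb + gs" "gs + gc = gc + gs"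
  "gt + ga = gb + ga + gt" "gt + gb = gb + gt" "gt + gc = gc + gt"
  using grp_relation[of 3 0 "[(0, True), (1, True)]"] grp_relation[of 3 1 "[(1, True)]"]
    grp_relation[of 3 2 "[(2, True)]"] grp_relation[of 4 0 "[(1, True), (0, True)]"]
    grp_relation[of 4 1 "[(1, True)]"] grp_relation[of 4 2 "[(2, True)]"]
  by (simp_all add: relators_def wval_Cons wval_Nil)

section \<open>Integer powers in additive notation\<close>

primrec npow :: "nat \<Rightarrow> grp \<Rightarrow> grp" where
  "npow 0 g = 0"
| "npow (Suc n) g = g + npow n g"

definition zpow :: "int \<Rightarrow> grp \<Rightarrow> grp" where
  "zpow n g = (if 0 \<le> n then npow (nat n) g else - npow (nat (- n)) g)"

lemma npow_commute_Suc: "npow n g + g = g + npow n g"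
  by (induction n) (simp_all add: add.assoc)

lemma zpow_0: "zpow 0 g = 0" by (simp add: zpow_def)

lemma zpow_1: "zpow 1 g = g" by (simp add: zpow_def)

lemma zpow_Suc: "zpow (n + 1) g = g + zpow n g"
proof (cases "0 \<le> n")
  case True
  then show ?thesis by (simp add: zpow_def nat_add_distrib)
next
  case False
  then obtain k where k: "n = - int (Suc k)"
    using negD not_le by blast
  have "- npow k g = g + - (g + npow k g)"
    by (simp add: npow_commute_Suc[symmetric] minus_add)
  then show ?thesis by (cases "k = 0") (simp_all add: zpow_def k nat_add_distrib)
qed

lemma zpow_pred: "zpow (n - 1) g = - g + zpow n g"
  using zpow_Suc[of "n - 1" g] by (simp add: add.assoc[symmetric])

lemma zpow_induct:
  assumes "P 0" "\<And>n. P n \<Longrightarrow> P (n + 1)" "\<And>n. P n \<Longrightarrow> P (n - 1 :: int)"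
  shows "P n"
  by (induction n rule: int_induct[of _ 0]) (use assms in auto)

lemma zpow_conj:
  assumes "x + g = h + x"
  shows "x + zpow n g = zpow n h + x"
proof (induction n rule: zpow_induct)
  case 1
  then show ?case by (simp add: zpow_0)
next
  case (2 n)
  then show ?case using assms by (metis add.assoc zpow_Suc)
next
  case (3 n)
  have "h + (x + - g) = x" using assms by (metis add.assoc right_minus add_0_right)
  then have "x + - g = - h + x" by (metis add.assoc left_minus add_0_left)
  then show ?case using 3 by (metis add.assoc zpow_pred)
qed

lemma zpow_commute: "x + g = g + x \<Longrightarrow> x + zpow n g = zpow n g + x"
  by (rule zpow_conj)

lemma zpow_add: "zpow (m + n) g = zpow m g + zpow n g"
proof (induction m rule: zpow_induct)
  case (2 m)
  then show ?case using zpow_Suc[of "m + n" g] zpow_Suc[of m g] by (simp add: ac_simps add.assoc)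
next
  case (3 m)
  have eq: "m - 1 + n = m + n - 1" by simp
  show ?case unfolding eq using 3 zpow_pred[of "m + n" g] zpow_pred[of m g] by (simp add: add.assoc)
qed (simp add: zpow_0)

lemma zpow_mult: "zpow (m * n) g = zpow n (zpow m g)"
proof (induction n rule: zpow_induct)
  case (2 n)
  have eq: "m * (n + 1) = m + m * n" by (simp add: algebra_simps)
  show ?case by (simp only: eq zpow_add[of m "m * n"] zpow_Suc 2)
next
  case (3 n)
  have "m * n = m + m * (n - 1)" by (simp add: algebra_simps)
  then have "zpow (m * n) g = zpow m g + zpow (m * (n - 1)) g" by (metis zpow_add)
  then show ?case using 3 zpow_pred[of n "zpow m g"] by (simp add: add.assoc[symmetric])
qed (simp add: zpow_0)

lemma zpow_plus_commute:
  assumes "g + h = h + g"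
  shows "zpow n (g + h) = zpow n g + zpow n h"
proof (induction n rule: zpow_induct)
  case (2 n)
  have "h + zpow n g = zpow n g + h" by (rule zpow_commute) (simp add: assms)
  then show ?case using 2 by (metis zpow_Suc add.assoc)
next
  case (3 n)
  have "- h + zpow n g = zpow n g + - h"
  proof (rule zpow_commute)
    have "- h + (g + h) + - h = - h + (h + g) + - h" by (simp add: assms)
    then show "- h + g = g + - h" by (simp add: add.assoc)
  qed
  moreover have "- (g + h) = - g + - h" by (simp add: assms minus_add)
  ultimately show ?case using 3 by (metis zpow_pred add.assoc)
qed (simp add: zpow_0)

text \<open>Conjugation by \<open>a\<close> turns \<open>s\<close> into \<open>b s\<close>, and the
  power of this product splits because \<open>b\<close> and \<open>s\<close> commute.\<close>

lemma zpow_s_a: "zpow n gs + ga = ga + (zpow n gb + zpow n gs)"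
proof -
  have "ga + (gb + gs) = gs + ga" by (simp add: grp_relations(1) add.assoc)
  then have "ga + zpow n (gb + gs) = zpow n gs + ga" by (rule zpow_conj)
  then show ?thesis by (simp add: zpow_plus_commute grp_relations(2))
qed

text \<open>For \<open>w = s^m t\<close> the relation \<open>w a = b a b^m w\<close> is rewritten as
  \<open>a (b^m w) = (b^-1 w) a\<close>, a form that passes to \<open>k\<close>-th powers; there
  \<open>b\<close> separates, as it commutes with \<open>w\<close>. The exponent
  \<open>m * k\<close> makes products expressible.\<close>

lemma zpow_st_a:
  "zpow k (zpow m gs + gt) + ga = zpow k gb + (ga + (zpow (m * k) gb + zpow k (zpow m gs + gt)))"
proof -
  let ?w = "zpow m gs + gt"
  have bs: "gb + zpow m gs = zpow m gs + gb" by (rule zpow_commute) (simp add: grp_relations)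
  have bw: "gb + ?w = ?w + gb" using bs grp_relations(5) by (metis add.assoc)
  have "?w + ga = zpow m gs + (gb + (ga + gt))" by (simp add: grp_relations(4) add.assoc)
  also have "\<dots> = gb + (zpow m gs + ga) + gt" using bs by (metis add.assoc)
  also have "\<dots> = gb + (ga + (zpow m gb + ?w))" by (simp add: zpow_s_a add.assoc)
  finally have wa: "?w + ga = gb + (ga + (zpow m gb + ?w))" .
  then have "ga + (zpow m gb + ?w) = (- gb + ?w) + ga" by (simp add: add.assoc)
  then have "ga + zpow k (zpow m gb + ?w) = zpow k (- gb + ?w) + ga" by (rule zpow_conj)
  moreover have "zpow k (zpow m gb + ?w) = zpow (m * k) gb + zpow k ?w"
    unfolding zpow_mult by (rule zpow_plus_commute) (metis bw zpow_commute)
  moreover have "zpow k (- gb + ?w) = - zpow k gb + zpow k ?w"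
  proof -
    have "gb + (- gb + ?w) = (- gb + ?w) + gb"
      by (simp add: add.assoc bw[symmetric, unfolded add.assoc])
    then have "zpow k (gb + (- gb + ?w)) = zpow k gb + zpow k (- gb + ?w)" by (rule zpow_plus_commute)
    then have "zpow k ?w = zpow k gb + zpow k (- gb + ?w)" by (simp add: add.assoc[symmetric])
    then show ?thesis by (simp add: add.assoc[symmetric])
  qed
  ultimately have "ga + (zpow (m * k) gb + zpow k ?w) = - zpow k gb + zpow k ?w + ga" by simp
  then show ?thesis by (simp add: add.assoc)
qed

end

section \<open>Invariants of group elements\<close>

type_synonym mat = "int \<times> int \<times> int \<times> int"
type_synonym state = "mat \<times> int \<times> int \<times> int"

fun upper :: "int \<Rightarrow> mat \<Rightarrow> mat" where
  "upper n (p, q, r, u) = (p, q + n * p, r, u + n * r)"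

fun lower :: "int \<Rightarrow> mat \<Rightarrow> mat" where
  "lower n (p, q, r, u) = (p + n * q, q, r + n * u, u)"

text \<open>The group element \<open>w u\<close>, with \<open>w\<close> in \<open>F(a, b, c)\<close> and \<open>u\<close> in \<open>F(s, t)\<close>, is tracked by the image
  \<open>W\<close> of \<open>w\<close> in \<open>SL\<^sub>2(\<int>)\<close>, where \<open>a\<close> and \<open>c\<close> have the same image, and by the coordinates
  \<open>(x, y, z)\<close> of \<open>u\<close> in the Heisenberg group.  Multiplication by \<open>a\<close> on the right turns \<open>w\<close> into
  \<open>w b\<^sup>y a b\<^sup>x\<close> because \<open>u a = b\<^sup>y a b\<^sup>x u\<close>.\<close>
fun act :: "letter \<Rightarrow> state \<Rightarrow> state" where
  "act (i, e) (W, x, y, z) =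
    (let k = if e then 1 else - 1 in
     if i = 0 then (if e then upper x (lower 1 (upper y W))
                    else upper (- y) (lower (- 1) (upper (- x) W)), x, y, z)
     else if i = 1 then (upper k W, x, y, z)
     else if i = 2 then (lower k W, x, y, z)
     else if i = 3 then (W, x + k, y, z)
     else if i = 4 then (W, x, y + k, z + k * x)
     else (W, x, y, z))"

lemma upper_upper: "upper m (upper n W) = upper (m + n) W"
  by (cases W) (simp add: algebra_simps)

lemma lower_lower: "lower m (lower n W) = lower (m + n) W"
  by (cases W) (simp add: algebra_simps)

lemma upper_0: "upper 0 W = W"
  by (cases W) simp

lemma lower_0: "lower 0 W = W"
  by (cases W) simp

lemma act_cancel: "act (i, \<not> e) (act (i, e) st) = st"
proof -
  obtain W x y z where st: "st = (W, x, y, z)" by (cases st)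
  show ?thesis
    unfolding st by (cases e) (auto simp: Let_def upper_upper lower_lower upper_0 lower_0)
qed

lemma act_relator: "r \<in> relators \<Longrightarrow> fold act r st = st"
proof -
  assume "r \<in> relators"
  moreover obtain W x y z where st: "st = (W, x, y, z)" by (cases st)
  ultimately show ?thesis
    unfolding relators_def st
    by (elim insertE emptyE)
      (simp_all add: inv_word_def Let_def upper_upper lower_lower upper_0 lower_0)
qed

lemma fold_act_G_eq: "G_eq u v \<Longrightarrow> fold act u = fold act v"
proof (induction rule: G_eq.induct)
  case (cancel i e)
  show ?case by (rule ext) (simp add: act_cancel)
next
  case (rel r)
  then show ?case by (intro ext) (simp add: act_relator)
qed auto

lift_definition run :: "grp \<Rightarrow> state \<Rightarrow> state" is "fold act"
  by (rule fold_act_G_eq)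

lemma run_plus: "run (g + h) st = run h (run g st)"
  by transfer simp

lemma run_gen: "run (gen i) = act (i, True)"
  by transfer (simp add: fun_eq_iff)

section \<open>Multiplication laws of the invariants\<close>

fun mmult :: "mat \<Rightarrow> mat \<Rightarrow> mat" where
  "mmult (a, b, c, d) (p, q, r, u) = (a * p + b * r, a * q + b * u, c * p + d * r, c * q + d * u)"

fun mdet :: "mat \<Rightarrow> int" where
  "mdet (a, b, c, d) = a * d - b * c"

lemma upper_mult: "upper n (mmult U W) = mmult U (upper n W)"
  by (cases U; cases W) (simp add: algebra_simps)

lemma lower_mult: "lower n (mmult U W) = mmult U (lower n W)"
  by (cases U; cases W) (simp add: algebra_simps)

lemma det_upper: "mdet (upper n W) = mdet W"
  by (cases W) (simp add: algebra_simps)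

lemma det_lower: "mdet (lower n W) = mdet W"
  by (cases W) (simp add: algebra_simps)

lemma mult_one: "mmult W (1, 0, 0, 1) = W"
  by (cases W) simp

fun translate :: "mat \<Rightarrow> int \<Rightarrow> state \<Rightarrow> state" where
  "translate U k (W, x, y, z) = (mmult U W, x, y, z + k)"

text \<open>Letters multiply the matrix on the right, so left multiplication passes through. The
  exponents \<open>x\<close> and \<open>y\<close> stay fixed, because the action of \<open>a\<close>
  depends on them.\<close>

lemma act_translate: "act l (translate U k st) = translate U k (act l st)"
proof -
  obtain i e where l: "l = (i, e)" by (cases l)
  obtain W x y z where st: "st = (W, x, y, z)" by (cases st)
  show ?thesis unfolding l st by (simp add: Let_def upper_mult lower_mult)
qed

lemma run_translate: "run g (translate U k st) = translate U k (run g st)"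
proof transfer
  fix w U k st
  show "fold act w (translate U k st) = translate U k (fold act w st)"
    by (induction w arbitrary: st) (simp_all add: act_translate)
qed

definition base :: state where "base = ((1, 0, 0, 1), 0, 0, 0)"
definition mat :: "grp \<Rightarrow> mat" where "mat g = fst (run g base)"
definition sig :: "grp \<Rightarrow> int" where "sig g = fst (snd (run g base))"
definition tau :: "grp \<Rightarrow> int" where "tau g = fst (snd (snd (run g base)))"
definition kap :: "grp \<Rightarrow> int" where "kap g = snd (snd (snd (run g base)))"

lemma run_base: "run g base = (mat g, sig g, tau g, kap g)"
  by (simp add: mat_def sig_def tau_def kap_def)

lemma run_at_origin: "run g (W, 0, 0, z) = (mmult W (mat g), sig g, tau g, kap g + z)"
  using run_translate[of g W z base] by (simp add: base_def mult_one flip: run_base[unfolded base_def])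
    (simp add: run_base[unfolded base_def])

lemma snd_run: "snd (run g (W, x, y, z)) = (x + sig g, y + tau g, z + kap g + x * tau g)"
proof -
  have "snd (fold act w (W, x, y, z)) =
      (x + fst (snd (fold act w base)), y + fst (snd (snd (fold act w base))),
       z + snd (snd (snd (fold act w base))) + x * fst (snd (snd (fold act w base))))" for w
  proof (induction w rule: rev_induct)
    case Nil
    then show ?case by (simp add: base_def)
  next
    case (snoc l w)
    obtain i e where l: "l = (i, e)" by (cases l)
    obtain V x' y' z' where 1: "fold act w (W, x, y, z) = (V, x', y', z')" by (cases "fold act w (W, x, y, z)")
    obtain V0 x0 y0 z0 where 0: "fold act w base = (V0, x0, y0, z0)" by (cases "fold act w base")
    show ?case using snoc by (simp add: 0 1 l Let_def algebra_simps)
  qed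
  then show ?thesis unfolding sig_def tau_def kap_def by transfer
qed

lemma run_base_plus:
  "run h (mat g, sig g, tau g, kap g) = (mat (g + h), sig (g + h), tau (g + h), kap (g + h))"
  by (simp only: run_base[symmetric] run_plus)

lemma sig_plus: "sig (g + h) = sig g + sig h"
  and tau_plus: "tau (g + h) = tau g + tau h"
  and kap_plus: "kap (g + h) = kap g + kap h + sig g * tau h"
  using snd_run[of h "mat g" "sig g" "tau g" "kap g"]
  by (simp_all add: run_base_plus)

text \<open>Without the assumptions the letters \<open>a\<close> of \<open>h\<close> are twisted by
  the exponents of \<open>g\<close>. No matrix homomorphism on the whole group could avoid this:
  \<open>a\<close> and \<open>c\<close> have the same image, but \<open>s\<close> moves
  \<open>a\<close> and fixes \<open>c\<close>.\<close>

lemma mat_plus: "sig g = 0 \<Longrightarrow> tau g = 0 \<Longrightarrow> mat (g + h) = mmult (mat g) (mat h)"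
  using run_base_plus[of h g] by (simp add: run_at_origin)

lemma invariants_gen:
  "sig ga = 0" "sig gb = 0" "sig gc = 0" "sig gs = 1" "sig gt = 0"
  "tau ga = 0" "tau gb = 0" "tau gc = 0" "tau gs = 0" "tau gt = 1"
  "mat ga = (1, 0, 1, 1)" "mat gb = (1, 1, 0, 1)" "mat gc = (1, 0, 1, 1)"
  by (simp_all add: sig_def tau_def mat_def run_gen base_def Let_def)

lemma invariants_0: "sig 0 = 0" "tau 0 = 0"
  using sig_plus[of 0 0] tau_plus[of 0 0] by simp_all

lemma mat_plus_gen:
  "mat (g + gen i) = fst (act (i, True) (mat g, sig g, tau g, kap g))"
  using run_base_plus[of "gen i" g] by (simp only: run_gen fst_conv)

lemma mat_plus_a: "mat (g + ga) = upper (sig g) (lower 1 (upper (tau g) (mat g)))"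
  and mat_plus_b: "mat (g + gb) = upper 1 (mat g)"
  and mat_plus_c: "mat (g + gc) = lower 1 (mat g)"
  by (simp_all add: mat_plus_gen Let_def)

lemma det_mat: "mdet (mat g) = 1"
proof -
  have "mdet (fst (fold act w base)) = 1" for w
  proof (induction w rule: rev_induct)
    case Nil
    then show ?case by (simp add: base_def)
  next
    case (snoc l w)
    obtain i e where l: "l = (i, e)" by (cases l)
    obtain V0 x0 y0 z0 where 0: "fold act w base = (V0, x0, y0, z0)" by (cases "fold act w base")
    show ?case using snoc by (simp add: 0 l Let_def det_upper det_lower)
  qed
  then show ?thesis unfolding mat_def by transfer
qed

section \<open>Exponents forced by equations\<close>

lemma commute_imp_det_0:
  assumes "g + h = h + g"
  shows "sig g * tau h = sig h * tau g"
  using arg_cong[OF assms, of kap] by (simp add: kap_plus)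

text \<open>A matrix commuting with both elementary matrices is scalar. Both products are
  computable: on the right \<open>b\<close> and \<open>c\<close> are not twisted, and on the left
  they have zero exponents.\<close>

lemma commute_b_c_imp_scalar:
  assumes "g + gb = gb + g" "g + gc = gc + g"
  obtains p where "mat g = (p, 0, 0, p)" "p \<noteq> 0"
proof -
  obtain p q r u where m: "mat g = (p, q, r, u)" by (cases "mat g")
  have "upper 1 (mat g) = mmult (1, 1, 0, 1) (mat g)"
    using arg_cong[OF assms(1), of mat] by (simp add: mat_plus_b mat_plus invariants_gen)
  moreover have "lower 1 (mat g) = mmult (1, 0, 1, 1) (mat g)"
    using arg_cong[OF assms(2), of mat] by (simp add: mat_plus_c mat_plus invariants_gen)
  ultimately have "r = 0" "q = 0" "u = p" by (simp_all add: m)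
  moreover have "p \<noteq> 0" using det_mat[of g] calculation by (auto simp: m)
  ultimately show ?thesis using that m by blast
qed

text \<open>Commuting with \<open>s\<close> removes the \<open>t\<close>-exponent of
  \<open>X\<close>. With elementary matrices \<open>L\<close>, \<open>U\<close> and the scalar
  \<open>p\<close> of \<open>X\<close>, the last equation reads \<open>p L U^i = L P p\<close> for
  \<open>i = sig X\<close>, so \<open>P\<close> has the matrix of \<open>b^i\<close>.\<close>

lemma power_of_s_invariants:
  assumes "X + gb = gb + X" "X + gc = gc + X" "X + gs = gs + X" and P: "X + ga = ga + (P + X)"
  shows "tau X = 0" "sig P = 0" "tau P = 0" "mat P = (1, sig X, 0, 1)"
proof -
  show tau: "tau X = 0" using commute_imp_det_0[OF assms(3)] by (simp add: invariants_gen)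
  show P0: "sig P = 0" "tau P = 0"
    using arg_cong[OF P, of sig] arg_cong[OF P, of tau] by (simp_all add: sig_plus tau_plus)
  obtain p where p: "mat X = (p, 0, 0, p)" "p \<noteq> 0"
    using commute_b_c_imp_scalar[OF assms(1,2)] by blast
  obtain a b c d where m: "mat P = (a, b, c, d)" by (cases "mat P")
  have "upper (sig X) (lower 1 (upper (tau X) (mat X))) = mmult (1, 0, 1, 1) (mmult (mat P) (mat X))"
    using arg_cong[OF P, of mat] by (simp add: mat_plus_a mat_plus invariants_gen P0)
  then have e: "a = 1" "b = sig X" "p = a * p + c * p" "p + sig X * p = b * p + d * p"
    using p(2) by (auto simp: tau p(1) m)
  then have "c = 0" "d = 1" using p(2) by simp_all
  then show "mat P = (1, sig X, 0, 1)" using e by (simp add: m)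
qed

text \<open>The matrix of \<open>b^i a b^j\<close> has diagonal entries \<open>1 + i\<close> and
  \<open>1 + j\<close>, so both exponents can be read off.\<close>

lemma product_invariants:
  assumes Z: "Z + gb = gb + Z" "Z + gc = gc + Z" and "Z + ga = P + (ga + (Q + Z))"
    and P: "sig P = 0" "tau P = 0" "mat P = (1, m, 0, 1)"
    and Q: "sig Q = 0" "tau Q = 0" "mat Q = (1, n, 0, 1)"
  shows "tau Z = m" "sig Z = n"
proof -
  obtain p where p: "mat Z = (p, 0, 0, p)" "p \<noteq> 0"
    using commute_b_c_imp_scalar[OF Z] by blast
  have "upper (sig Z) (lower 1 (upper (tau Z) (mat Z))) =
      mmult (mat P) (mmult (1, 0, 1, 1) (mmult (mat Q) (mat Z)))"
    using arg_cong[OF assms(3), of mat] by (simp add: mat_plus_a mat_plus invariants_gen P Q)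
  then have e: "p + tau Z * p = p + m * p" "p + sig Z * p = n * p + p"
    by (simp_all add: p P Q algebra_simps)
  then show "tau Z = m" "sig Z = n" using p(2) by simp_all
qed

section \<open>Polynomial equations as systems over the group\<close>

instance pexp :: countable
  by countable_datatype

text \<open>Variable indices begin at 5, and the residue modulo 3 keeps the three families apart.
  Numbering by subexpressions makes equal subexpressions share their variables.\<close>

definition xi :: "pexp \<Rightarrow> nat" where "xi e = 5 + 3 * to_nat e"
definition bi :: "pexp \<Rightarrow> nat" where "bi e = 6 + 3 * to_nat e"
definition zi :: "pexp \<Rightarrow> pexp \<Rightarrow> nat" where "zi e f = 7 + 3 * prod_encode (to_nat e, to_nat f)"

definition eqn :: "nat list \<Rightarrow> nat list \<Rightarrow> word" where
  "eqn u v = map (\<lambda>i. (i, True)) u @ inv_word (map (\<lambda>i. (i, True)) v)"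

lemma wval_positive: "wval f (map (\<lambda>i. (i, True)) u) = sum_list (map f u)"
  by (induction u) (simp_all add: wval_Cons wval_Nil)

lemma wval_eqn: "wval f (eqn u v) = 0 \<longleftrightarrow> sum_list (map f u) = sum_list (map f v)"
  by (simp add: eqn_def wval_append wval_inv_word wval_positive)

text \<open>The value \<open>n\<close> of the subexpression \<open>e\<close> is represented by \<open>s\<^sup>n\<close> and \<open>b\<^sup>n\<close>, the values of the
  variables \<^term>\<open>xi e\<close> and \<^term>\<open>bi e\<close>; the product of \<open>m\<close> and \<open>n\<close> is read off from
  \<open>(s\<^sup>m t)\<^sup>n\<close>, the value of a variable of the form \<^term>\<open>zi p q\<close>.\<close>
definition base_eqns :: "pexp \<Rightarrow> word list" where
  "base_eqns e = [eqn [xi e, gB] [gB, xi e], eqn [xi e, gC] [gC, xi e], eqn [xi e, gS] [gS, xi e],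
     eqn [xi e, gA] [gA, bi e, xi e]]"

primrec psys :: "pexp \<Rightarrow> word list" where
  "psys (Par i) = base_eqns (Par i)"
| "psys (Unk i) = base_eqns (Unk i)"
| "psys PZero = eqn [xi PZero] [] # base_eqns PZero"
| "psys POne = eqn [xi POne] [gS] # base_eqns POne"
| "psys (PAdd p q) = eqn [xi p, xi q] [xi (PAdd p q)] # base_eqns (PAdd p q) @ psys p @ psys q"
| "psys (PMul p q) =
    [eqn [zi p q, gB] [gB, zi p q], eqn [zi p q, gC] [gC, zi p q],
     eqn [zi p q, xi p, gT] [xi p, gT, zi p q], eqn [zi p q, gA] [bi q, gA, bi (PMul p q), zi p q]]
    @ base_eqns (PMul p q) @ psys p @ psys q"

definition gens :: "(nat \<Rightarrow> grp) \<Rightarrow> bool" where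
  "gens f \<longleftrightarrow> f 0 = ga \<and> f (Suc 0) = gb \<and> f 2 = gc \<and> f 3 = gs \<and> f 4 = gt"

definition represents :: "(nat \<Rightarrow> grp) \<Rightarrow> pexp \<Rightarrow> bool" where
  "represents f e \<longleftrightarrow> tau (f (xi e)) = 0 \<and> sig (f (bi e)) = 0 \<and> tau (f (bi e)) = 0 \<and>
    mat (f (bi e)) = (1, sig (f (xi e)), 0, 1)"

lemma base_eqns_represents:
  assumes "gens f" "\<forall>w\<in>set (base_eqns e). wval f w = 0"
  shows "represents f e"
proof -
  have "f (xi e) + gb = gb + f (xi e)" "f (xi e) + gc = gc + f (xi e)" "f (xi e) + gs = gs + f (xi e)"
    "f (xi e) + ga = ga + (f (bi e) + f (xi e))"
    using assms by (simp_all add: base_eqns_def wval_eqn gens_def)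
  from power_of_s_invariants[OF this] show ?thesis by (simp add: represents_def)
qed

lemma psys_complete:
  assumes "gens f" "\<forall>w\<in>set (psys e). wval f w = 0"
  shows "represents f e \<and>
    sig (f (xi e)) = pval e (\<lambda>i. sig (f (xi (Par i)))) (\<lambda>i. sig (f (xi (Unk i))))"
  using assms(2)
proof (induction e)
  case (Par i)
  then show ?case using base_eqns_represents[OF assms(1)] by simp
next
  case (Unk i)
  then show ?case using base_eqns_represents[OF assms(1)] by simp
next
  case PZero
  then have "f (xi PZero) = 0" by (simp add: wval_eqn)
  then show ?case using base_eqns_represents[OF assms(1)] PZero by (simp add: invariants_0)
next
  case POne
  then have "f (xi POne) = gs" using assms(1) by (simp add: wval_eqn gens_def)
  then show ?case using base_eqns_represents[OF assms(1)] POne by (simp add: invariants_gen)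
next
  case (PAdd p q)
  then have "f (xi p) + f (xi q) = f (xi (PAdd p q))" by (simp add: wval_eqn)
  from arg_cong[OF this, of sig] show ?case
    using base_eqns_represents[OF assms(1)] PAdd by (simp add: sig_plus)
next
  case (PMul p q)
  let ?X = "f (xi p)" and ?Z = "f (zi p q)"
  have IH: "represents f p" "represents f q" using PMul by simp_all
  have e: "represents f (PMul p q)" using base_eqns_represents[OF assms(1)] PMul by simp
  have eqs: "?Z + gb = gb + ?Z" "?Z + gc = gc + ?Z" "?Z + (?X + gt) = (?X + gt) + ?Z"
    "?Z + ga = f (bi q) + (ga + (f (bi (PMul p q)) + ?Z))"
    using PMul.prems assms(1) by (simp_all add: wval_eqn gens_def add.assoc)
  have "tau ?Z = sig (f (xi q))" "sig ?Z = sig (f (xi (PMul p q)))"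
    using product_invariants[OF eqs(1,2,4)] IH(2) e by (simp_all add: represents_def)
  \<comment> \<open>The exponent vector of \<open>?X + gt\<close> is \<open>(sig ?X, 1)\<close>, and
    that of the commuting \<open>?Z\<close> is proportional to it.\<close>
  moreover have "sig ?Z = sig ?X * tau ?Z"
    using commute_imp_det_0[OF eqs(3)] IH(1)
    by (simp add: represents_def sig_plus tau_plus invariants_gen)
  ultimately have "sig (f (xi (PMul p q))) = sig (f (xi p)) * sig (f (xi q))" by simp
  then show ?case using e PMul by simp
qed

lemma psys_sound:
  fixes v w :: "nat \<Rightarrow> int"
  assumes "gens f" and X: "\<And>e. f (xi e) = zpow (pval e v w) gs"
    and B: "\<And>e. f (bi e) = zpow (pval e v w) gb"
    and Z: "\<And>d e. f (zi d e) = zpow (pval e v w) (zpow (pval d v w) gs + gt)"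
  shows "\<forall>u\<in>set (psys e). wval f u = 0"
proof -
  have s: "zpow n gs + gb = gb + zpow n gs" "zpow n gs + gc = gc + zpow n gs"
    "zpow n gs + gs = gs + zpow n gs" for n
    using zpow_commute[of gb gs n] zpow_commute[of gc gs n] zpow_commute[of gs gs n]
    by (simp_all add: grp_relations)
  have base: "\<forall>u\<in>set (base_eqns e). wval f u = 0" for e
    using assms(1) by (simp add: base_eqns_def wval_eqn gens_def X B s zpow_s_a)
  have st: "zpow k (zpow n gs + gt) + gb = gb + zpow k (zpow n gs + gt)"
    "zpow k (zpow n gs + gt) + gc = gc + zpow k (zpow n gs + gt)"
    "zpow k (zpow n gs + gt) + (zpow n gs + gt) = zpow n gs + (gt + zpow k (zpow n gs + gt))" for k n
  proof -
    have "gb + (zpow n gs + gt) = (zpow n gs + gt) + gb"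
      using s(1) grp_relations(5) by (metis add.assoc)
    from zpow_commute[OF this] show "zpow k (zpow n gs + gt) + gb = gb + zpow k (zpow n gs + gt)" ..
    have "gc + (zpow n gs + gt) = (zpow n gs + gt) + gc"
      using s(2) grp_relations(6) by (metis add.assoc)
    from zpow_commute[OF this] show "zpow k (zpow n gs + gt) + gc = gc + zpow k (zpow n gs + gt)" ..
    show "zpow k (zpow n gs + gt) + (zpow n gs + gt) = zpow n gs + (gt + zpow k (zpow n gs + gt))"
      using zpow_commute[of "zpow n gs + gt" "zpow n gs + gt" k] by (simp add: add.assoc)
  qed
  show ?thesis
  proof (induction e)
    case PZero
    then show ?case using base by (simp add: wval_eqn X zpow_0)
  next
    case POne
    then show ?case using base assms(1) by (simp add: wval_eqn X zpow_1 gens_def)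
  next
    case (PAdd p q)
    then show ?case using base by (auto simp: wval_eqn X zpow_add)
  next
    case (PMul p q)
    have "\<forall>u\<in>set (take 4 (psys (PMul p q))). wval f u = 0"
      using assms(1) by (simp add: wval_eqn gens_def X B Z st zpow_st_a)
    then show ?case using base PMul by auto
  qed (use base in auto)
qed

definition wpow :: "int \<Rightarrow> word \<Rightarrow> word" where
  "wpow n w = (if 0 \<le> n then concat (replicate (nat n) w)
    else inv_word (concat (replicate (nat (- n)) w)))"

lemma abs_concat_replicate: "abs_grp (concat (replicate n w)) = npow n (abs_grp w)"
  by (induction n) (simp_all add: zero_grp.abs_eq flip: plus_grp.abs_eq)

lemma abs_wpow: "abs_grp (wpow n w) = zpow n (abs_grp w)"
  by (simp add: wpow_def zpow_def abs_concat_replicate flip: uminus_grp.abs_eq)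

lemma G_word_append: "G_word (u @ v) \<longleftrightarrow> G_word u \<and> G_word v"
  by (auto simp: G_word_def)

lemma G_word_inv_word: "G_word (inv_word w) \<longleftrightarrow> G_word w"
  by (force simp: G_word_def inv_word_def)

lemma G_word_wpow: "G_word w \<Longrightarrow> G_word (wpow n w)"
  by (auto simp: wpow_def G_word_inv_word) (auto simp: G_word_def)

text \<open>The inverted variable stands in front, so that the rest of the word is a constant list
  whose code arises by a simple recursion.\<close>

definition input_eqn :: "nat \<Rightarrow> word" where
  "input_eqn n = (xi (Par 0), False) # replicate n (gS, True)"

lemma wval_input_eqn: "wval f (input_eqn n) = 0 \<longleftrightarrow> f (xi (Par 0)) = npow n (f gS)"
proof -
  have "wval f (replicate n (gS, True)) = npow n (f gS)"
    by (induction n) (simp_all add: wval_Cons wval_Nil)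
  then show ?thesis by (auto simp: input_eqn_def wval_Cons neg_eq_iff_add_eq_0[symmetric])
qed

lemma sig_npow: "sig (npow n g) = int n * sig g"
  by (induction n) (simp_all add: invariants_0 sig_plus algebra_simps)

lemma solvable_psys_iff:
  "solvable (input_eqn n # eqn [xi p] [xi q] # psys p @ psys q) \<longleftrightarrow>
    (\<exists>v w :: nat \<Rightarrow> int. v 0 = int n \<and> pval p v w = pval q v w)"
proof
  assume "solvable (input_eqn n # eqn [xi p] [xi q] # psys p @ psys q)"
  then obtain \<sigma> where *: "\<forall>u\<in>set (input_eqn n # eqn [xi p] [xi q] # psys p @ psys q).
      wval (\<lambda>i. if i < 5 then gen i else abs_grp (\<sigma> i)) u = 0"
    unfolding solvable_iff by blast
  define f where "f = (\<lambda>i. if i < 5 then gen i else abs_grp (\<sigma> i))"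
  have f: "gens f" by (simp add: gens_def f_def)
  note * = *[folded f_def]
  have "f (xi (Par 0)) = npow n gs" using * f by (simp add: wval_input_eqn gens_def)
  then have "sig (f (xi (Par 0))) = int n" by (simp add: sig_npow invariants_gen)
  moreover have "f (xi p) = f (xi q)" using * by (simp add: wval_eqn)
  ultimately show "\<exists>v w :: nat \<Rightarrow> int. v 0 = int n \<and> pval p v w = pval q v w"
    using psys_complete[OF f, of p] psys_complete[OF f, of q] *
    by (intro exI[of _ "\<lambda>i. sig (f (xi (Par i)))"] exI[of _ "\<lambda>i. sig (f (xi (Unk i)))"]) simp
next
  assume "\<exists>v w :: nat \<Rightarrow> int. v 0 = int n \<and> pval p v w = pval q v w"
  then obtain v w :: "nat \<Rightarrow> int" where vw: "v 0 = int n" "pval p v w = pval q v w" by blast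
  define ev where "ev k = pval (from_nat k) v w" for k
  \<comment> \<open>This inverts the numbering of \<open>xi\<close>, \<open>bi\<close> and
    \<open>zi\<close>. Explicit words are needed because a solution must consist of words over the
    generators.\<close>
  define \<sigma> :: "nat \<Rightarrow> word" where "\<sigma> j = (let k = (j - 5) div 3 in
      if (j - 5) mod 3 = 0 then wpow (ev k) [(gS, True)]
      else if (j - 5) mod 3 = 1 then wpow (ev k) [(gB, True)]
      else case prod_decode k of (d, e) \<Rightarrow> wpow (ev e) (wpow (ev d) [(gS, True)] @ [(gT, True)]))" for j
  define f where "f = (\<lambda>i. if i < 5 then gen i else abs_grp (\<sigma> i))"
  have f: "gens f" by (simp add: gens_def f_def)
  have ev: "ev (to_nat e) = pval e v w" for e by (simp add: ev_def)
  have X: "f (xi e) = zpow (pval e v w) gs" for e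
    by (simp add: f_def xi_def \<sigma>_def ev abs_wpow abs_letter)
  have "Suc (3 * k) div 3 = k" "Suc (3 * k) mod 3 = 1" for k :: nat by presburger+
  then have B: "f (bi e) = zpow (pval e v w) gb" for e
    by (simp add: f_def bi_def \<sigma>_def ev abs_wpow abs_letter)
  have "Suc (Suc (3 * k)) div 3 = k" "Suc (Suc (3 * k)) mod 3 = 2" for k :: nat by presburger+
  then have Z: "f (zi d e) = zpow (pval e v w) (zpow (pval d v w) gs + gt)" for d e
    by (simp add: f_def zi_def \<sigma>_def ev abs_wpow abs_letter flip: plus_grp.abs_eq)
  have "\<forall>u\<in>set (psys e). wval f u = 0" for e by (rule psys_sound[OF f X B Z])
  moreover have "wval f (eqn [xi p] [xi q]) = 0" by (simp add: wval_eqn X vw)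
  moreover have "wval f (input_eqn n) = 0"
    using f by (simp add: wval_input_eqn X vw gens_def zpow_def)
  ultimately have "\<forall>u\<in>set (input_eqn n # eqn [xi p] [xi q] # psys p @ psys q). wval f u = 0" by auto
  moreover have "G_word (\<sigma> j)" for j
    unfolding \<sigma>_def Let_def
    by (auto simp: G_word_append intro!: G_word_wpow split: prod.split) (auto simp: G_word_def)
  ultimately show "solvable (input_eqn n # eqn [xi p] [xi q] # psys p @ psys q)"
    unfolding solvable_iff f_def by blast
qed

lemma pval_int: "pval p (\<lambda>i. int (v i)) (\<lambda>i. int (w i)) = int (pval p v w)"
  by (induction p) simp_all

text \<open>Each natural unknown becomes a sum of four squares of integer unknowns. The parameter 0
  is natural by the input equation, and all other parameters are set to 0.\<close>

lemma dioph_imp_solvable: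
  assumes "dioph P"
  shows "\<exists>S. \<forall>n. solvable (input_eqn n # S) \<longleftrightarrow> P (\<lambda>i. if i = 0 then n else 0)"
proof -
  obtain p q where pq: "\<And>v. P v \<longleftrightarrow> (\<exists>w. pval p v w = pval q v w)"
    using assms unfolding dioph_def by blast
  define sq where "sq j = PMul (Unk j) (Unk j)" for j
  define tr where "tr = psub (\<lambda>i. if i = 0 then Par 0 else PZero)
      (\<lambda>j. PAdd (PAdd (sq (4 * j)) (sq (4 * j + 1))) (PAdd (sq (4 * j + 2)) (sq (4 * j + 3))))"
  define sm :: "(nat \<Rightarrow> int) \<Rightarrow> nat \<Rightarrow> int" where "sm w j = w (4 * j) * w (4 * j) +
      w (4 * j + 1) * w (4 * j + 1) + (w (4 * j + 2) * w (4 * j + 2) + w (4 * j + 3) * w (4 * j + 3))" for w j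
  have tr: "pval (tr e) v w = pval e (\<lambda>i. if i = 0 then v 0 else 0) (sm w)" for e and v w :: "nat \<Rightarrow> int"
    unfolding tr_def pval_psub by (rule arg_cong2[where f = "pval e"]) (auto simp: sm_def sq_def)
  have sm: "\<exists>u. w = (\<lambda>j. nat (sm u j)) \<and> (\<forall>j. 0 \<le> sm u j)" for w :: "nat \<Rightarrow> nat"
  proof -
    have "\<exists>g. int (w j) = g 0 * g 0 + g 1 * g 1 + (g 2 * g 2 + g 3 * g (3 :: nat))" for j
    proof -
      obtain a b c d where "int (w j) = a * a + b * b + c * c + d * d"
        using four_squares_nat[of "w j"] unfolding four_squares_def by blast
      then show ?thesis by (intro exI[of _ "\<lambda>i. [a, b, c, d] ! i"]) (simp add: numeral_3_eq_3)
    qed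
    then obtain g where g: "\<And>j. int (w j) = g j 0 * g j 0 + g j 1 * g j 1 + (g j 2 * g j 2 + g j 3 * g j (3 :: nat))"
      by metis
    have "(4 * j) div 4 = j" "(4 * j) mod 4 = 0" "(4 * j + 1) div 4 = j" "(4 * j + 1) mod 4 = 1"
      "(4 * j + 2) div 4 = j" "(4 * j + 2) mod 4 = 2" "(4 * j + 3) div 4 = j" "(4 * j + 3) mod 4 = 3"
      for j :: nat by presburger+
    then have "sm (\<lambda>k. g (k div 4) (k mod 4)) j = int (w j)" for j
      unfolding sm_def g by (simp only:)
    then show ?thesis by (intro exI[of _ "\<lambda>k. g (k div 4) (k mod 4)"]) simp
  qed
  have "solvable (input_eqn n # eqn [xi (tr p)] [xi (tr q)] # psys (tr p) @ psys (tr q)) \<longleftrightarrow>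
      P (\<lambda>i. if i = 0 then n else 0)" for n
  proof -
    have param: "(\<exists>v w. v 0 = int n \<and> R (v (0 :: nat)) w) \<longleftrightarrow> (\<exists>w. R (int n) w)" for R
      by (auto intro: exI[of _ "\<lambda>_. int n"])
    have "(\<exists>v w :: nat \<Rightarrow> int. v 0 = int n \<and> pval (tr p) v w = pval (tr q) v w) \<longleftrightarrow>
        (\<exists>w. pval p (\<lambda>i. if i = 0 then int n else 0) (sm w) = pval q (\<lambda>i. if i = 0 then int n else 0) (sm w))"
      unfolding tr by (rule param)
    also have "\<dots> \<longleftrightarrow> (\<exists>w. pval p (\<lambda>i. if i = 0 then n else 0) w = pval q (\<lambda>i. if i = 0 then n else 0) w)"
    proof -
      have "pval e (\<lambda>i. if i = 0 then int n else 0) (sm w) =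
          int (pval e (\<lambda>i. if i = 0 then n else 0) (\<lambda>j. nat (sm w j)))" if "\<forall>j. 0 \<le> sm w j" for e w
        using that unfolding pval_int[symmetric] by (intro arg_cong2[where f = "pval e"]) auto
      moreover have "\<forall>j. 0 \<le> sm w j" for w by (simp add: sm_def)
      ultimately show ?thesis using sm by (auto, metis)
    qed
    finally show ?thesis unfolding solvable_psys_iff pq .
  qed
  then show ?thesis by blast
qed

section \<open>Diagonalisation\<close>

lemma inj_letter_code: "inj letter_code"
proof (rule injI)
  fix k l :: letter
  assume *: "letter_code k = letter_code l"
  have "odd (letter_code l) \<longleftrightarrow> snd l" for l by (simp add: letter_code_def)
  then have "snd k = snd l" using * by metis
  then show "k = l" using * by (auto simp: letter_code_def prod_eq_iff)
qed

lemma inj_system_code: "inj system_code"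
proof -
  have "inj (\<lambda>w. list_encode (map letter_code w))"
    by (simp add: inj_def list_encode_eq inj_map_eq_map[OF inj_letter_code])
  from inj_map_eq_map[OF this] show ?thesis
    by (intro injI) (simp add: system_code_def list_encode_eq)
qed

lemma system_code_in_iff: "system_code S \<in> diophantine_problem_G \<longleftrightarrow> solvable S"
  using inj_system_code by (auto simp: diophantine_problem_G_def inj_def)

section \<open>Recursive functions on codes of systems\<close>

lemma eval_CompI:
  "list_all2 (\<lambda>g y. eval g xs y) fs ys \<Longrightarrow> eval f ys y \<Longrightarrow> eval (Comp f fs) xs y"
  by (rule eval.comp) (auto simp: list_all2_conv_all_nth)

lemma eval_SuccI: "y = Suc x \<Longrightarrow> eval Succ [x] y"
  by (simp add: eval_Succ_iff)

definition rf_add :: recf where "rf_add = Prim (Proj 0) (Comp Succ [Proj 0])"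

lemma eval_add: "eval rf_add [m, n] (m + n)"
  unfolding rf_add_def
proof (induction m)
  case 0
  show ?case by (rule eval.prim0) (simp add: eval_Proj_iff)
next
  case (Suc m)
  show ?case
    by (rule eval.primS[OF Suc], rule eval_CompI[of _ _ "[m + n]"])
      (simp_all add: eval_Proj_iff eval_Succ_iff)
qed

definition rf_triangle :: recf where
  "rf_triangle = Prim Zero (Comp rf_add [Proj 0, Comp Succ [Proj 1]])"

lemma eval_triangle: "eval rf_triangle [n] (triangle n)"
  unfolding rf_triangle_def
proof (induction n)
  case 0
  show ?case by (rule eval.prim0) (simp add: eval_Zero_iff)
next
  case (Suc n)
  have "eval (Comp Succ [Proj 1]) [triangle n, n] (Suc n)"
    by (rule eval_CompI[of _ _ "[n]"]) (simp_all add: eval_Proj_iff eval_Succ_iff)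
  then have "eval (Comp rf_add [Proj 0, Comp Succ [Proj 1]]) [triangle n, n] (triangle n + Suc n)"
    by (intro eval_CompI[OF _ eval_add]) (simp add: eval_Proj_iff)
  then show ?case by (simp only: triangle_Suc) (rule eval.primS[OF Suc])
qed

definition rf_pair :: recf where
  "rf_pair = Comp rf_add [Comp rf_triangle [rf_add], Proj 0]"

lemma eval_pair: "eval rf_pair [m, n] (prod_encode (m, n))"
proof -
  have "eval (Comp rf_triangle [rf_add]) [m, n] (triangle (m + n))"
    by (rule eval_CompI[OF _ eval_triangle]) (simp add: eval_add)
  then show ?thesis
    unfolding rf_pair_def prod_encode_def prod.case
    by (intro eval_CompI[OF _ eval_add]) (simp add: eval_Proj_iff)
qed

primrec rf_const :: "nat \<Rightarrow> recf" where
  "rf_const 0 = Zero"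
| "rf_const (Suc n) = Comp Succ [rf_const n]"

lemma eval_const: "eval (rf_const n) xs n"
proof (induction n)
  case (Suc n)
  then show ?case by (auto intro!: eval_CompI[of _ _ "[n]"] eval_SuccI)
qed (simp add: eval_Zero_iff)

text \<open>\<open>list_encode\<close> sends a nonempty list to the successor of the pair code of
  its head and the code of its tail.\<close>

definition rf_cons :: "recf \<Rightarrow> recf \<Rightarrow> recf" where
  "rf_cons f g = Comp Succ [Comp rf_pair [f, g]]"

lemma eval_cons:
  assumes "eval f xs m" "eval g xs n"
  shows "eval (rf_cons f g) xs (Suc (prod_encode (m, n)))"
proof -
  have "eval (Comp rf_pair [f, g]) xs (prod_encode (m, n))"
    by (rule eval_CompI[OF _ eval_pair]) (simp add: assms)
  then show ?thesis
    unfolding rf_cons_def by (intro eval_CompI[OF _ eval_SuccI[OF HOL.refl]]) simp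
qed

text \<open>Here \<open>7 = 2 * 3 + 1\<close> is the code of the letter \<open>s\<close>, and
  \<open>2 * xi (Par 0)\<close> that of the inverted input variable. The argument is used twice: as
  the input and as the code of the system that receives it.\<close>

definition rf_input :: recf where
  "rf_input = rf_cons
     (rf_cons (rf_const (2 * xi (Par 0))) (Prim Zero (rf_cons (rf_const 7) (Proj 0)))) (Proj 0)"

lemma eval_input: "eval rf_input [system_code S] (system_code (input_eqn (system_code S) # S))"
proof -
  have replicate: "eval (Prim Zero (rf_cons (rf_const 7) (Proj 0))) [n] (list_encode (replicate n 7))" for n
  proof (induction n)
    case 0
    show ?case by (rule eval.prim0) (simp add: eval_Zero_iff)
  next
    case (Suc n)
    show ?case
      unfolding replicate_Suc list_encode.simps
      by (rule eval.primS[OF Suc], rule eval_cons[OF eval_const]) (simp add: eval_Proj_iff)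
  qed
  have eq: "system_code (input_eqn n # S) =
      Suc (prod_encode (Suc (prod_encode (2 * xi (Par 0), list_encode (replicate n 7))), system_code S))" for n
    by (simp add: system_code_def input_eqn_def letter_code_def)
  show ?thesis
    unfolding rf_input_def eq
    by (intro eval_cons eval_const replicate) (simp add: eval_Proj_iff)
qed

theorem theorem6p5:
  shows "\<not> decidable_set diophantine_problem_G"
proof
  assume "decidable_set diophantine_problem_G"
  then obtain d where d: "\<And>n. eval d [n] (if n \<in> diophantine_problem_G then 1 else 0)"
    unfolding decidable_set_def by blast
  have "dioph (\<lambda>v. eval (Comp d [rf_input]) (map (\<lambda>g. g v) [\<lambda>v. v 0]) 0)"
    by (rule dioph_eval) (auto intro: dfun_par dfun_const)
  \<comment> \<open>Output 0 means rejection, so \<open>S\<close> with input \<open>n\<close>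
    asserts that the system with code \<open>n\<close> is unsolvable on its own code.\<close>
  then obtain S where
    S: "\<And>n. solvable (input_eqn n # S) \<longleftrightarrow> eval (Comp d [rf_input]) [n] 0"
    using dioph_imp_solvable by fastforce
  define m where "m = system_code (input_eqn (system_code S) # S)"
  have "eval (Comp d [rf_input]) [system_code S] (if m \<in> diophantine_problem_G then 1 else 0)"
    using eval_input[of S] by (intro eval_CompI[OF _ d[of m]]) (simp add: m_def)
  \<comment> \<open>Values are unique, so output 1 excludes output 0.\<close>
  then have "eval (Comp d [rf_input]) [system_code S] 0 \<longleftrightarrow> m \<notin> diophantine_problem_G"
    using eval_deterministic by (auto split: if_splits)
  then show False using S[of "system_code S"] by (simp add: m_def system_code_in_iff)
qed

end
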